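(* Let $\mathcal{S}=\langle\mathcal{C}^1,\ldots,\mathcal{C}^n,\mathsf{M},\Gamma\rangle$ be a parametric system and let $\phi\mapsto\phi^{\oplus}$ be a positivation operator on $\mathsf{MIL}$ sentences. Then \[\Theta(\mathcal{N}_\mathcal{S})\equiv\mathrm{B}_\mathsf{M}\Big(\widetilde{\big(\Theta(\Gamma)\wedge\mathrm{Init}(\mathcal{S})\big)^{\oplus}}\Big).\]
   Context: Component types $\mathcal{C}^k=\langle\mathsf{P}^k,\mathsf{S}^k,s_0^k,\Delta^k\rangle$, $k\in[1,n]$ (finite ports, finite states, initial state, transitions $s\xrightarrow{p}s'$; no two different transitions carry the same port; disjoint port/state sets); $\mathsf{M}:[1,n]\to\mathbb{N}$ gives the number of instances per type. $\mathsf{MIL}$: unary predicate symbols $\mathsf{Pred}_k=\mathsf{P}^k\cup\mathsf{S}^k$, index variables $\mathsf{Var}_k$ (disjoint across $k$); formulae $\phi::=i=j\mid\mathsf{pred}(i)\mid\phi\wedge\phi\mid\neg\phi\mid\exists i.\phi$ ($\mathsf{pred}(i)$ requires $\mathsf{pred}\in\mathsf{Pred}_k$, $i\in\mathsf{Var}_k$), usual abbreviations. Structures $(\mathfrak{U},\nu,\iota)$, $\mathfrak{U}=[1,\max_k\mathsf{M}(k)]$, $\nu:\mathsf{Var}\to\mathfrak{U}$, $\iota:\mathsf{Pred}\to2^\mathfrak{U}$; standard semantics with $\exists i$, $i\in\mathsf{Var}_k$, ranging over $[1,\mathsf{M}(k)]$. Order: $\mathcal{I}_1\subseteq\mathcal{I}_2$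 iff $\iota_1(p)\subseteq\iota_2(p)$ for all $p$; minimal models are those with no model strictly below; $\phi_1\equiv^\mu\phi_2$ iff they have the same minimal models. A formula is positive if every predicate symbol occurs under an even number of negations. A positivation operator maps each $\mathsf{MIL}$ sentence $\phi$ to a positive sentence $\phi^{\oplus}$ with $\phi\equiv^\mu\phi^{\oplus}$. Dual of $\mathsf{MIL}$ formulae (applied to positive formulae written in negation normal form with negation only on equalities): $\widetilde{i=j}=\neg i=j$, $\widetilde{\neg i=j}=i=j$, $\widetilde{p(i)}=p(i)$, $\widetilde{\phi_1\vee\phi_2}=\widetilde{\phi_1}\wedge\widetilde{\phi_2}$, $\widetilde{\phi_1\wedge\phi_2}=\widetilde{\phi_1}\vee\widetilde{\phi_2}$, $\widetilde{\exists i.\phi_1}=\forall i.\widetilde{\phi_1}$, $\widetilde{\forall i.\phi_1}=\exists i.\widetilde{\phi_1}$. Unfolding $\mathrm{B}_\mathsf{M}(\phi)$: replace $\exists i.\psi$ / $\forall i.\psi$ ($i\in\mathsf{Var}_k$) by $\bigvee_{\ell=1}^{\mathsf{M}(k)}\psi[\ell/i]$ / $\bigwedge_{\ell=1}^{\mathsf{M}(k)}\psi[\ell/i]$, where $\mathsf{pred}(i)[\ell/i]$ becomes the propositional variable $(\mathsf{pred},\ell)$ and equalities of constants evaluate to $\top/\bot$. Interaction formula $\Gamma$: a finite disjunction of formulae $\exists i_1\ldots\exists i_\ell.\,\varphi\wedge\bigwedge_{j=1}^\ell p_j(i_j)\wedge\bigwedge_{j=\ell+1}^{\ell+m}\forall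 i_j.\,\psi_j\rightarrow p_j(i_j)$ with $p_j$ ports, $\varphi,\psi_j$ conjunctions of (dis)equalities of index variables. Marked Petri net $\mathcal{N}_\mathcal{S}$: places $(s,k)$ with $s\in\mathsf{S}^t$, $k\in[1,\mathsf{M}(t)]$; initial marking with exactly the places $(s_0^t,k)$ marked; for each minimal model $\mathcal{I}=(\mathfrak{U},\nu,\iota)$ of $\Gamma$ a transition $\mathfrak{t}_\mathcal{I}$ with edges $((s,k),\mathfrak{t}_\mathcal{I}),(\mathfrak{t}_\mathcal{I},(s',k))$ for every component transition $s\xrightarrow{p}s'$ and $k\in\iota(p)$. A trap is a set $W$ of places such that every transition with an input place in $W$ has an output place in $W$; marked if it contains an initially marked place. $\Theta(\mathcal{N}_\mathcal{S}):=\bigwedge\{\bigvee_{i=1}^k w_i\mid\{w_1,\ldots,w_k\}\text{ marked trap of }\mathcal{N}_\mathcal{S}\}$, a boolean formula over the places $(s,k)$ viewed as propositional variables; $\equiv$ is boolean equivalence. For a port $p$ with transition $s\xrightarrow{p}s'$: ${}^\bullet p(i):=s(i)$, $p^\bullet(i):=s'(i)$ ($\bot$ if none). $\Theta(\Gamma)$ is the conjunction over the disjuncts of $\Gamma$ of $\forall i_1\ldots\forall i_\ell.[\varphi\wedge(\bigvee_{j=1}^\ell{}^\bullet p_j(i_j)\vee\bigvee_{j=\ell+1}^{\ell+m}\exists i_j.\psi_j\wedge{}^\bullet p_j(i_j))]\rightarrow[\bigvee_{j=1}^\ell p_j^\bullet(i_j)\vee\bigvee_{j=\ell+1}^{\ell+m}\exists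 i_j.\psi_j\wedge p_j^\bullet(i_j)]$. $\mathrm{Init}(\mathcal{S}):=\bigvee_{k=1}^n\exists i_k.\,s_0^k(i_k)$.
   Formalization: Added assumption: for each disjunct of Γ and each choice of its existential indices satisfying φ, the described set of port-index pairs is a union of minimal models of Γ (otherwise the claim can fail); also at least one component type has an instance. *)

theory Defs
  imports "HOL-Library.FuncSet" "HOL-Library.FSet"
begin

subsection \<open>Component types\<close>

record ('p, 's) component =
  ports :: "'p set"
  states :: "'s set"
  init_state :: 's
  trans :: "('s \<times> 'p \<times> 's) set"

definition component_type :: "('p, 's) component \<Rightarrow> bool" where
  "component_type C \<longleftrightarrow>
     finite (ports C) \<and> finite (states C) \<and> init_state C \<in> states C \<and>
     trans C \<subseteq> states C \<times> ports C \<times> states C \<and>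
     (\<forall>s p s' r r'. (s, p, s') \<in> trans C \<longrightarrow> (r, p, r') \<in> trans C \<longrightarrow> s = r \<and> s' = r')"


subsection \<open>Syntax of MIL\<close>

text \<open>The tagged union makes ports and states disjoint. An index variable is a pair of its sort
  \<open>k\<close> and a name, so the sets of index variables of different sorts are disjoint.\<close>

datatype ('p, 's) pred = Port 'p | State 's

type_synonym ivar = "nat \<times> nat"

abbreviation sort_of :: "ivar \<Rightarrow> nat" where
  "sort_of \<equiv> fst"

datatype ('p, 's) mil =
    MEq ivar ivar
  | MPred "('p, 's) pred" ivar
  | MAnd "('p, 's) mil" "('p, 's) mil"
  | MNeg "('p, 's) mil"
  | MEx ivar "('p, 's) mil"

definition MOr :: "('p, 's) mil \<Rightarrow> ('p, 's) mil \<Rightarrow> ('p, 's) mil" where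
  "MOr \<phi> \<psi> = MNeg (MAnd (MNeg \<phi>) (MNeg \<psi>))"

definition MImp :: "('p, 's) mil \<Rightarrow> ('p, 's) mil \<Rightarrow> ('p, 's) mil" where
  "MImp \<phi> \<psi> = MOr (MNeg \<phi>) \<psi>"

definition MAll :: "ivar \<Rightarrow> ('p, 's) mil \<Rightarrow> ('p, 's) mil" where
  "MAll i \<phi> = MNeg (MEx i (MNeg \<phi>))"

text \<open>A closed contradiction: false even if no index has sort \<open>1\<close>.\<close>

definition MBot :: "('p, 's) mil" where
  "MBot = MEx (1, 0) (MNeg (MEq (1, 0) (1, 0)))"

definition MTop :: "('p, 's) mil" where
  "MTop = MNeg MBot"

definition MConj :: "('p, 's) mil list \<Rightarrow> ('p, 's) mil" where
  "MConj \<phi>s = foldr MAnd \<phi>s MTop"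

definition MDisj :: "('p, 's) mil list \<Rightarrow> ('p, 's) mil" where
  "MDisj \<phi>s = foldr MOr \<phi>s MBot"

definition MExs :: "ivar list \<Rightarrow> ('p, 's) mil \<Rightarrow> ('p, 's) mil" where
  "MExs is \<phi> = foldr MEx is \<phi>"

definition MAlls :: "ivar list \<Rightarrow> ('p, 's) mil \<Rightarrow> ('p, 's) mil" where
  "MAlls is \<phi> = foldr MAll is \<phi>"

primrec fv :: "('p, 's) mil \<Rightarrow> ivar set" where
  "fv (MEq i j) = {i, j}"
| "fv (MPred q i) = {i}"
| "fv (MAnd \<phi> \<psi>) = fv \<phi> \<union> fv \<psi>"
| "fv (MNeg \<phi>) = fv \<phi>"
| "fv (MEx i \<phi>) = fv \<phi> - {i}"

text \<open>\<open>polarity b \<phi>\<close>: every occurrence of a predicate symbol in \<open>\<phi>\<close> is under an even number of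
  negations if \<open>b\<close> holds, and under an odd number otherwise.\<close>

primrec polarity :: "bool \<Rightarrow> ('p, 's) mil \<Rightarrow> bool" where
  "polarity b (MEq i j) = True"
| "polarity b (MPred q i) = b"
| "polarity b (MAnd \<phi> \<psi>) = (polarity b \<phi> \<and> polarity b \<psi>)"
| "polarity b (MNeg \<phi>) = polarity (\<not> b) \<phi>"
| "polarity b (MEx i \<phi>) = polarity b \<phi>"

definition positive :: "('p, 's) mil \<Rightarrow> bool" where
  "positive \<phi> = polarity True \<phi>"


subsection \<open>Interaction formulae\<close>

datatype eqlit = EqL ivar ivar | NeqL ivar ivar

primrec eqlit_mil :: "eqlit \<Rightarrow> ('p, 's) mil" where
  "eqlit_mil (EqL i j) = MEq i j"
| "eqlit_mil (NeqL i j) = MNeg (MEq i j)"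

definition eq_conj :: "eqlit list \<Rightarrow> ('p, 's) mil" where
  "eq_conj ls = MConj (map eqlit_mil ls)"

text \<open>A disjunct of an interaction formula: the conjunction \<open>\<phi>\<close> (\<open>guard\<close>), the pairs
  \<open>(p\<^sub>j, i\<^sub>j)\<close> with \<open>j \<le> l\<close> (\<open>rdv\<close>), and the triples \<open>(i\<^sub>j, \<psi>\<^sub>j, p\<^sub>j)\<close> with
  \<open>l < j \<le> l + m\<close> (\<open>bcast\<close>).\<close>

record 'p clause =
  guard :: "eqlit list"
  rdv :: "('p \<times> ivar) list"
  bcast :: "(ivar \<times> eqlit list \<times> 'p) list"

definition clause_mil :: "'p clause \<Rightarrow> ('p, 's) mil" where
  "clause_mil c =
     MExs (map snd (rdv c))
       (MAnd (eq_conj (guard c))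
         (MAnd (MConj (map (\<lambda>(p, i). MPred (Port p) i) (rdv c)))
           (MConj (map (\<lambda>(i, \<psi>, p). MAll i (MImp (eq_conj \<psi>) (MPred (Port p) i))) (bcast c)))))"

definition interaction_mil :: "'p clause list \<Rightarrow> ('p, 's) mil" where
  "interaction_mil cs = MDisj (map clause_mil cs)"


subsection \<open>Parametric systems\<close>

text \<open>\<open>ctype\<close> and \<open>insts\<close> are only relevant on \<open>{1..num S}\<close>.\<close>

record ('p, 's) system =
  num :: nat
  ctype :: "nat \<Rightarrow> ('p, 's) component"
  insts :: "nat \<Rightarrow> nat"
  gamma :: "'p clause list"

definition preds_of :: "('p, 's) system \<Rightarrow> nat \<Rightarrow> ('p, 's) pred set" where
  "preds_of S k = Port ` ports (ctype S k) \<union> State ` states (ctype S k)"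

definition all_preds :: "('p, 's) system \<Rightarrow> ('p, 's) pred set" where
  "all_preds S = (\<Union>k\<in>{1..num S}. preds_of S k)"

definition all_vars :: "('p, 's) system \<Rightarrow> ivar set" where
  "all_vars S = {i. sort_of i \<in> {1..num S}}"

primrec wf_mil :: "('p, 's) system \<Rightarrow> ('p, 's) mil \<Rightarrow> bool" where
  "wf_mil S (MEq i j) = (i \<in> all_vars S \<and> j \<in> all_vars S)"
| "wf_mil S (MPred q i) = (i \<in> all_vars S \<and> q \<in> preds_of S (sort_of i))"
| "wf_mil S (MAnd \<phi> \<psi>) = (wf_mil S \<phi> \<and> wf_mil S \<psi>)"
| "wf_mil S (MNeg \<phi>) = wf_mil S \<phi>"
| "wf_mil S (MEx i \<phi>) = (i \<in> all_vars S \<and> wf_mil S \<phi>)"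

definition mil_sentence :: "('p, 's) system \<Rightarrow> ('p, 's) mil \<Rightarrow> bool" where
  "mil_sentence S \<phi> \<longleftrightarrow> wf_mil S \<phi> \<and> fv \<phi> = {}"

text \<open>At least one component instance is required to exist: otherwise the universe of MIL
  structures is empty and there are no structures at all. Individual component types may have
  no instance.\<close>

definition parametric_system :: "('p, 's) system \<Rightarrow> bool" where
  "parametric_system S \<longleftrightarrow>
     (\<forall>k\<in>{1..num S}. component_type (ctype S k)) \<and>
     (\<forall>k\<in>{1..num S}. \<forall>l\<in>{1..num S}. k \<noteq> l \<longrightarrow>
        ports (ctype S k) \<inter> ports (ctype S l) = {} \<and> states (ctype S k) \<inter> states (ctype S l) = {}) \<and>
     (\<exists>k\<in>{1..num S}. 1 \<le> insts S k) \<and>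
     (\<forall>c\<in>set (gamma S). mil_sentence S (clause_mil c :: ('p, 's) mil))"


subsection \<open>Structures and minimal models\<close>

type_synonym ('p, 's) struct = "(ivar \<Rightarrow> nat) \<times> (('p, 's) pred \<Rightarrow> nat set)"

definition univ :: "('p, 's) system \<Rightarrow> nat set" where
  "univ S = {1..Max (insts S ` {1..num S})}"

definition structs :: "('p, 's) system \<Rightarrow> ('p, 's) struct set" where
  "structs S = (all_vars S \<rightarrow>\<^sub>E univ S) \<times> (all_preds S \<rightarrow>\<^sub>E Pow (univ S))"

primrec sat :: "(nat \<Rightarrow> nat) \<Rightarrow> (ivar \<Rightarrow> nat) \<Rightarrow> (('p, 's) pred \<Rightarrow> nat set) \<Rightarrow> ('p, 's) mil \<Rightarrow> bool"
  where
  "sat M \<nu> \<iota> (MEq i j) = (\<nu> i = \<nu> j)"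
| "sat M \<nu> \<iota> (MPred q i) = (\<nu> i \<in> \<iota> q)"
| "sat M \<nu> \<iota> (MAnd \<phi> \<psi>) = (sat M \<nu> \<iota> \<phi> \<and> sat M \<nu> \<iota> \<psi>)"
| "sat M \<nu> \<iota> (MNeg \<phi>) = (\<not> sat M \<nu> \<iota> \<phi>)"
| "sat M \<nu> \<iota> (MEx i \<phi>) = (\<exists>a\<in>{1..M (sort_of i)}. sat M (\<nu>(i := a)) \<iota> \<phi>)"

definition models :: "('p, 's) system \<Rightarrow> ('p, 's) mil \<Rightarrow> ('p, 's) struct set" where
  "models S \<phi> = {(\<nu>, \<iota>) \<in> structs S. sat (insts S) \<nu> \<iota> \<phi>}"

definition struct_le :: "('p, 's) system \<Rightarrow> ('p, 's) struct \<Rightarrow> ('p, 's) struct \<Rightarrow> bool" where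
  "struct_le S I J \<longleftrightarrow> (\<forall>q\<in>all_preds S. snd I q \<subseteq> snd J q)"

definition min_models :: "('p, 's) system \<Rightarrow> ('p, 's) mil \<Rightarrow> ('p, 's) struct set" where
  "min_models S \<phi> =
     {I \<in> models S \<phi>. \<not> (\<exists>J\<in>models S \<phi>. struct_le S J I \<and> \<not> struct_le S I J)}"

definition min_equiv :: "('p, 's) system \<Rightarrow> ('p, 's) mil \<Rightarrow> ('p, 's) mil \<Rightarrow> bool" where
  "min_equiv S \<phi> \<psi> \<longleftrightarrow> min_models S \<phi> = min_models S \<psi>"

definition positivation :: "('p, 's) system \<Rightarrow> (('p, 's) mil \<Rightarrow> ('p, 's) mil) \<Rightarrow> bool" where
  "positivation S pos \<longleftrightarrow>
     (\<forall>\<phi>. mil_sentence S \<phi> \<longrightarrow>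
        mil_sentence S (pos \<phi>) \<and> positive (pos \<phi>) \<and> min_equiv S \<phi> (pos \<phi>))"


subsection \<open>Positive formulae in negation normal form and their duals\<close>

datatype ('p, 's) pnnf =
    NEq ivar ivar
  | NNeq ivar ivar
  | NPred "('p, 's) pred" ivar
  | NAnd "('p, 's) pnnf" "('p, 's) pnnf"
  | NOr "('p, 's) pnnf" "('p, 's) pnnf"
  | NEx ivar "('p, 's) pnnf"
  | NAll ivar "('p, 's) pnnf"

text \<open>\<open>nnf True \<phi>\<close> and \<open>nnf False \<phi>\<close> are the negation normal forms of \<open>\<phi>\<close> and \<open>MNeg \<phi>\<close>. The
  unspecified value is not reached by \<open>nnf True\<close> on a positive formula.\<close>

primrec nnf :: "bool \<Rightarrow> ('p, 's) mil \<Rightarrow> ('p, 's) pnnf" where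
  "nnf b (MEq i j) = (if b then NEq i j else NNeq i j)"
| "nnf b (MPred q i) = (if b then NPred q i else undefined)"
| "nnf b (MAnd \<phi> \<psi>) = (if b then NAnd (nnf b \<phi>) (nnf b \<psi>) else NOr (nnf b \<phi>) (nnf b \<psi>))"
| "nnf b (MNeg \<phi>) = nnf (\<not> b) \<phi>"
| "nnf b (MEx i \<phi>) = (if b then NEx i (nnf b \<phi>) else NAll i (nnf b \<phi>))"

primrec dual :: "('p, 's) pnnf \<Rightarrow> ('p, 's) pnnf" where
  "dual (NEq i j) = NNeq i j"
| "dual (NNeq i j) = NEq i j"
| "dual (NPred q i) = NPred q i"
| "dual (NAnd \<phi> \<psi>) = NOr (dual \<phi>) (dual \<psi>)"
| "dual (NOr \<phi> \<psi>) = NAnd (dual \<phi>) (dual \<psi>)"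
| "dual (NEx i \<phi>) = NAll i (dual \<phi>)"
| "dual (NAll i \<phi>) = NEx i (dual \<phi>)"


subsection \<open>Boolean formulae and unfolding\<close>

datatype 'a bform =
    BVar 'a
  | BNeg "'a bform"
  | BConj "'a bform fset"
  | BDisj "'a bform fset"

primrec beval :: "('a \<Rightarrow> bool) \<Rightarrow> 'a bform \<Rightarrow> bool" where
  "beval \<beta> (BVar x) = \<beta> x"
| "beval \<beta> (BNeg f) = (\<not> beval \<beta> f)"
| "beval \<beta> (BConj F) = (\<forall>b\<in>fset (beval \<beta> |`| F). b)"
| "beval \<beta> (BDisj F) = (\<exists>b\<in>fset (beval \<beta> |`| F). b)"

definition bequiv :: "'a bform \<Rightarrow> 'a bform \<Rightarrow> bool" where
  "bequiv f g \<longleftrightarrow> (\<forall>\<beta>. beval \<beta> f = beval \<beta> g)"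

definition BTop :: "'a bform" where
  "BTop = BConj {||}"

definition BBot :: "'a bform" where
  "BBot = BDisj {||}"

text \<open>The environment \<open>e\<close> collects the substitutions of indices for the bound variables whose
  quantifiers have been unfolded.\<close>

primrec unfold_env ::
  "(nat \<Rightarrow> nat) \<Rightarrow> (ivar \<Rightarrow> nat) \<Rightarrow> ('p, 's) pnnf \<Rightarrow> (('p, 's) pred \<times> nat) bform" where
  "unfold_env M e (NEq i j) = (if e i = e j then BTop else BBot)"
| "unfold_env M e (NNeq i j) = (if e i = e j then BBot else BTop)"
| "unfold_env M e (NPred q i) = BVar (q, e i)"
| "unfold_env M e (NAnd \<phi> \<psi>) = BConj {|unfold_env M e \<phi>, unfold_env M e \<psi>|}"
| "unfold_env M e (NOr \<phi> \<psi>) = BDisj {|unfold_env M e \<phi>, unfold_env M e \<psi>|}"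
| "unfold_env M e (NEx i \<phi>) =
     BDisj (fset_of_list (map (\<lambda>l. unfold_env M (e(i := l)) \<phi>) [1..<Suc (M (sort_of i))]))"
| "unfold_env M e (NAll i \<phi>) =
     BConj (fset_of_list (map (\<lambda>l. unfold_env M (e(i := l)) \<phi>) [1..<Suc (M (sort_of i))]))"

text \<open>For sentences the initial environment is irrelevant.\<close>

definition bool_unfolding :: "(nat \<Rightarrow> nat) \<Rightarrow> ('p, 's) pnnf \<Rightarrow> (('p, 's) pred \<times> nat) bform" where
  "bool_unfolding M \<phi> = unfold_env M (\<lambda>_. 0) \<phi>"


subsection \<open>Marked Petri nets\<close>

record ('pl, 't) petri_net =
  places :: "'pl set"
  transitions :: "'t set"
  in_edges :: "('pl \<times> 't) set"
  out_edges :: "('t \<times> 'pl) set"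
  init_marking :: "'pl \<Rightarrow> nat"

definition trap :: "('pl, 't) petri_net \<Rightarrow> 'pl set \<Rightarrow> bool" where
  "trap N W \<longleftrightarrow> W \<subseteq> places N \<and>
     (\<forall>t\<in>transitions N. (\<exists>w\<in>W. (w, t) \<in> in_edges N) \<longrightarrow> (\<exists>w\<in>W. (t, w) \<in> out_edges N))"

definition marked :: "('pl, 't) petri_net \<Rightarrow> 'pl set \<Rightarrow> bool" where
  "marked N W \<longleftrightarrow> (\<exists>w\<in>W. init_marking N w > 0)"

definition system_net :: "('p, 's) system \<Rightarrow> ('s \<times> nat, ('p, 's) struct) petri_net" where
  "system_net S =
     \<lparr> places = {(s, a). \<exists>k\<in>{1..num S}. s \<in> states (ctype S k) \<and> a \<in> {1..insts S k}},
       transitions = min_models S (interaction_mil (gamma S)),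
       in_edges = {((s, a), (\<nu>, \<iota>)) | s a \<nu> \<iota> k p s'.
          (\<nu>, \<iota>) \<in> min_models S (interaction_mil (gamma S)) \<and>
          k \<in> {1..num S} \<and> (s, p, s') \<in> trans (ctype S k) \<and> a \<in> \<iota> (Port p)},
       out_edges = {((\<nu>, \<iota>), (s', a)) | s' a \<nu> \<iota> k p s.
          (\<nu>, \<iota>) \<in> min_models S (interaction_mil (gamma S)) \<and>
          k \<in> {1..num S} \<and> (s, p, s') \<in> trans (ctype S k) \<and> a \<in> \<iota> (Port p)},
       init_marking = (\<lambda>(s, a).
          if \<exists>k\<in>{1..num S}. s = init_state (ctype S k) \<and> a \<in> {1..insts S k} then 1 else 0) \<rparr>"

text \<open>For a net with finitely many places, as \<open>system_net S\<close> is, all the sets below are finite.\<close>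

definition trap_invariant :: "('s \<times> nat, 't) petri_net \<Rightarrow> (('p, 's) pred \<times> nat) bform" where
  "trap_invariant N =
     BConj (Abs_fset {BDisj (Abs_fset ((\<lambda>(s, a). BVar (State s, a)) ` W)) | W.
       trap N W \<and> marked N W})"


subsection \<open>The trap and initial-marking formulae of a parametric system\<close>

definition pre_port :: "('p, 's) system \<Rightarrow> 'p \<Rightarrow> ivar \<Rightarrow> ('p, 's) mil" where
  "pre_port S p i =
     (if \<exists>s s'. (s, p, s') \<in> trans (ctype S (sort_of i))
      then MPred (State (THE s. \<exists>s'. (s, p, s') \<in> trans (ctype S (sort_of i)))) i
      else MBot)"

definition post_port :: "('p, 's) system \<Rightarrow> 'p \<Rightarrow> ivar \<Rightarrow> ('p, 's) mil" where
  "post_port S p i =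
     (if \<exists>s s'. (s, p, s') \<in> trans (ctype S (sort_of i))
      then MPred (State (THE s'. \<exists>s. (s, p, s') \<in> trans (ctype S (sort_of i)))) i
      else MBot)"

definition clause_trap :: "('p, 's) system \<Rightarrow> 'p clause \<Rightarrow> ('p, 's) mil" where
  "clause_trap S c =
     MAlls (map snd (rdv c))
       (MImp
         (MAnd (eq_conj (guard c))
           (MOr (MDisj (map (\<lambda>(p, i). pre_port S p i) (rdv c)))
             (MDisj (map (\<lambda>(i, \<psi>, p). MEx i (MAnd (eq_conj \<psi>) (pre_port S p i))) (bcast c)))))
         (MOr (MDisj (map (\<lambda>(p, i). post_port S p i) (rdv c)))
           (MDisj (map (\<lambda>(i, \<psi>, p). MEx i (MAnd (eq_conj \<psi>) (post_port S p i))) (bcast c)))))"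

definition trap_mil :: "('p, 's) system \<Rightarrow> ('p, 's) mil" where
  "trap_mil S = MConj (map (clause_trap S) (gamma S))"

definition init_mil :: "('p, 's) system \<Rightarrow> ('p, 's) mil" where
  "init_mil S =
     MDisj (map (\<lambda>k. MEx (k, 0) (MPred (State (init_state (ctype S k))) (k, 0))) [1..<Suc (num S)])"


subsection \<open>Interactions that are covered by minimal models\<close>

text \<open>The set of pairs \<open>(p, a)\<close> of a port and an index that the disjunct \<open>c\<close> makes interact when
  its existentially quantified variables take the values \<open>\<nu>\<close>.\<close>

definition clause_interaction ::
  "('p, 's) system \<Rightarrow> 'p clause \<Rightarrow> (ivar \<Rightarrow> nat) \<Rightarrow> ('p \<times> nat) set" where
  "clause_interaction S c \<nu> =
     {(p, \<nu> i) | p i. (p, i) \<in> set (rdv c)} \<union>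
     {(p, a) | p a i \<psi>. (i, \<psi>, p) \<in> set (bcast c) \<and> a \<in> {1..insts S (sort_of i)} \<and>
        sat (insts S) (\<nu>(i := a)) (\<lambda>_. {}) (eq_conj \<psi> :: ('p, 's) mil)}"

definition struct_interaction :: "('p, 's) system \<Rightarrow> ('p, 's) struct \<Rightarrow> ('p \<times> nat) set" where
  "struct_interaction S I = {(p, a). Port p \<in> all_preds S \<and> a \<in> snd I (Port p)}"

text \<open>Every interaction described by a disjunct is a union of minimal models of the interaction
  formula. Without this, an interaction that properly contains another one need not contribute a
  transition to the net although it contributes a conjunct to \<open>trap_mil\<close>. For instance, in
  \<open>(\<exists>i. p(i)) \<or> (\<exists>i j. p(i) \<and> q(j))\<close> no minimal model involves \<open>q\<close>, but the
  second disjunct constrains the places around \<open>q\<close> in \<open>trap_mil\<close>.\<close>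

definition interactions_covered :: "('p, 's) system \<Rightarrow> bool" where
  "interactions_covered S \<longleftrightarrow>
     (\<forall>c\<in>set (gamma S). \<forall>\<nu>.
        (\<forall>i\<in>snd ` set (rdv c). \<nu> i \<in> {1..insts S (sort_of i)}) \<longrightarrow>
        sat (insts S) \<nu> (\<lambda>_. {}) (eq_conj (guard c) :: ('p, 's) mil) \<longrightarrow>
        clause_interaction S c \<nu> =
          \<Union>{struct_interaction S I | I. I \<in> min_models S (interaction_mil (gamma S)) \<and>
                struct_interaction S I \<subseteq> clause_interaction S c \<nu>})"

end

theory Submission
  imports Defs
begin

text \<open>
  A valuation \<open>\<beta>\<close> of the places determines the structure \<open>\<I>\<close> of all predicates that \<open>\<beta>\<close> makes
  false. Dualizing a positive sentence amounts to negating it over the complemented valuation, so the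
  right-hand side holds at \<open>\<beta>\<close> iff \<open>\<I>\<close> is not a model of the positivation. The positivation is
  monotone and has the same minimal models as \<open>\<Theta>(\<Gamma>) \<and> Init\<close>, and below every model there is a minimal
  one; so this means that no model of \<open>\<Theta>(\<Gamma>) \<and> Init\<close> lies below \<open>\<I>\<close>. These models are the
  marked traps of the net, and such a trap lies below \<open>\<I>\<close> iff it falsifies its disjunction
  under \<open>\<beta>\<close>. That the trap formula describes traps rests on the correspondence between interactions
  of the disjuncts of \<open>\<Gamma>\<close> and transitions: every transition is such an interaction by minimality, and
  conversely every interaction is a union of transitions because interactions are covered.
\<close>

subsection \<open>Derived connectives\<close>

lemma sat_MOr [simp]: "sat M \<nu> \<iota> (MOr \<phi> \<psi>) \<longleftrightarrow> sat M \<nu> \<iota> \<phi> \<or> sat M \<nu> \<iota> \<psi>"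
  by (simp add: MOr_def)

lemma sat_MImp [simp]: "sat M \<nu> \<iota> (MImp \<phi> \<psi>) \<longleftrightarrow> (sat M \<nu> \<iota> \<phi> \<longrightarrow> sat M \<nu> \<iota> \<psi>)"
  by (auto simp: MImp_def)

lemma sat_MAll [simp]:
  "sat M \<nu> \<iota> (MAll i \<phi>) \<longleftrightarrow> (\<forall>a\<in>{1..M (sort_of i)}. sat M (\<nu>(i := a)) \<iota> \<phi>)"
  by (simp add: MAll_def)

lemma sat_MBot [simp]: "\<not> sat M \<nu> \<iota> MBot"
  by (simp add: MBot_def)

lemma sat_MTop [simp]: "sat M \<nu> \<iota> MTop"
  by (simp add: MTop_def)

lemma sat_MConj [simp]: "sat M \<nu> \<iota> (MConj \<phi>s) \<longleftrightarrow> (\<forall>\<phi>\<in>set \<phi>s. sat M \<nu> \<iota> \<phi>)"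
  by (induction \<phi>s) (auto simp: MConj_def)

lemma sat_MDisj [simp]: "sat M \<nu> \<iota> (MDisj \<phi>s) \<longleftrightarrow> (\<exists>\<phi>\<in>set \<phi>s. sat M \<nu> \<iota> \<phi>)"
  by (induction \<phi>s) (auto simp: MDisj_def)

text \<open>All assignments that a block of quantifiers over \<open>V\<close> can reach from
  \<open>\<nu>\<close>. A set in place of a list suffices: only the innermost binder of a variable
  takes effect, so order and repetitions do not matter.\<close>

definition reassign :: "(nat \<Rightarrow> nat) \<Rightarrow> ivar set \<Rightarrow> (ivar \<Rightarrow> nat) \<Rightarrow> (ivar \<Rightarrow> nat) set" where
  "reassign M V \<nu> = {\<mu>. (\<forall>i\<in>V. \<mu> i \<in> {1..M (sort_of i)}) \<and> (\<forall>i. i \<notin> V \<longrightarrow> \<mu> i = \<nu> i)}"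

lemma reassign_empty [simp]: "reassign M {} \<nu> = {\<nu>}"
  by (auto simp: reassign_def)

text \<open>Also valid for \<open>i \<in> V\<close>: then the choice \<open>a\<close> is
  overwritten, and \<open>\<mu> i\<close> itself witnesses that the range is nonempty. Hence
  induction over lists of bound variables needs no freshness condition.\<close>

lemma reassign_insert:
  "reassign M (insert i V) \<nu> = (\<Union>a\<in>{1..M (sort_of i)}. reassign M V (\<nu>(i := a)))"
proof (intro equalityI subsetI)
  fix \<mu> assume "\<mu> \<in> reassign M (insert i V) \<nu>"
  then have "\<mu> i \<in> {1..M (sort_of i)}" "\<mu> \<in> reassign M V (\<nu>(i := \<mu> i))"
    by (auto simp: reassign_def)
  then show "\<mu> \<in> (\<Union>a\<in>{1..M (sort_of i)}. reassign M V (\<nu>(i := a)))"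
    by blast
next
  fix \<mu> assume "\<mu> \<in> (\<Union>a\<in>{1..M (sort_of i)}. reassign M V (\<nu>(i := a)))"
  then obtain a where a: "a \<in> {1..M (sort_of i)}" "\<mu> \<in> reassign M V (\<nu>(i := a))"
    by blast
  then have "\<mu> i \<in> {1..M (sort_of i)}"
    by (cases "i \<in> V") (simp_all add: reassign_def del: split_paired_All)
  with a(2) show "\<mu> \<in> reassign M (insert i V) \<nu>"
    by (auto simp: reassign_def)
qed

lemma sat_MExs [simp]:
  "sat M \<nu> \<iota> (MExs is \<phi>) \<longleftrightarrow> (\<exists>\<mu>\<in>reassign M (set is) \<nu>. sat M \<mu> \<iota> \<phi>)"
  by (induction "is" arbitrary: \<nu>) (auto simp: MExs_def reassign_insert)

lemma sat_MAlls [simp]: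
  "sat M \<nu> \<iota> (MAlls is \<phi>) \<longleftrightarrow> (\<forall>\<mu>\<in>reassign M (set is) \<nu>. sat M \<mu> \<iota> \<phi>)"
  by (induction "is" arbitrary: \<nu>) (auto simp: MAlls_def reassign_insert)

text \<open>Free of \<open>M\<close> and \<open>\<iota>\<close>: equality literals do not look at
  predicates, so the empty interpretation in \<open>clause_interaction\<close> and the
  interpretation of any structure give the same value.\<close>

primrec eqlit_holds :: "(ivar \<Rightarrow> nat) \<Rightarrow> eqlit \<Rightarrow> bool" where
  "eqlit_holds \<nu> (EqL i j) = (\<nu> i = \<nu> j)"
| "eqlit_holds \<nu> (NeqL i j) = (\<nu> i \<noteq> \<nu> j)"

lemma sat_eq_conj [simp]: "sat M \<nu> \<iota> (eq_conj ls) \<longleftrightarrow> (\<forall>l\<in>set ls. eqlit_holds \<nu> l)"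
proof -
  have "sat M \<nu> \<iota> (eqlit_mil l) = eqlit_holds \<nu> l" for l
    by (cases l) auto
  then show ?thesis
    by (simp add: eq_conj_def)
qed

section \<open>Free variables and well-formedness of the derived connectives\<close>

lemma fv_MOr [simp]: "fv (MOr \<phi> \<psi>) = fv \<phi> \<union> fv \<psi>"
  and fv_MImp [simp]: "fv (MImp \<phi> \<psi>) = fv \<phi> \<union> fv \<psi>"
  and fv_MAll [simp]: "fv (MAll i \<phi>) = fv \<phi> - {i}"
  and fv_MBot [simp]: "fv MBot = {}"
  and fv_MTop [simp]: "fv MTop = {}"
  by (auto simp: MOr_def MImp_def MAll_def MBot_def MTop_def)

lemma fv_MConj [simp]: "fv (MConj \<phi>s) = (\<Union>\<phi>\<in>set \<phi>s. fv \<phi>)"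
  by (induction \<phi>s) (auto simp: MConj_def)

lemma fv_MDisj [simp]: "fv (MDisj \<phi>s) = (\<Union>\<phi>\<in>set \<phi>s. fv \<phi>)"
  by (induction \<phi>s) (auto simp: MDisj_def)

lemma fv_MExs [simp]: "fv (MExs is \<phi>) = fv \<phi> - set is"
  by (induction "is") (auto simp: MExs_def)

lemma fv_MAlls [simp]: "fv (MAlls is \<phi>) = fv \<phi> - set is"
  by (induction "is") (auto simp: MAlls_def)

lemma wf_MOr [simp]: "wf_mil S (MOr \<phi> \<psi>) \<longleftrightarrow> wf_mil S \<phi> \<and> wf_mil S \<psi>"
  and wf_MImp [simp]: "wf_mil S (MImp \<phi> \<psi>) \<longleftrightarrow> wf_mil S \<phi> \<and> wf_mil S \<psi>"
  and wf_MAll [simp]: "wf_mil S (MAll i \<phi>) \<longleftrightarrow> i \<in> all_vars S \<and> wf_mil S \<phi>"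
  by (auto simp: MOr_def MImp_def MAll_def)

lemma wf_MExs [simp]: "wf_mil S (MExs is \<phi>) \<longleftrightarrow> set is \<subseteq> all_vars S \<and> wf_mil S \<phi>"
  by (induction "is") (auto simp: MExs_def)

lemma wf_MAlls [simp]: "wf_mil S (MAlls is \<phi>) \<longleftrightarrow> set is \<subseteq> all_vars S \<and> wf_mil S \<phi>"
  by (induction "is") (auto simp: MAlls_def)

text \<open>\<open>MBot\<close> binds the variable \<open>(1, 0)\<close>, which belongs to the
  system only if sort \<open>1\<close> exists; list conjunctions and disjunctions inherit this
  condition.\<close>

lemma wf_MBot [simp]: "1 \<le> num S \<Longrightarrow> wf_mil S MBot"
  and wf_MTop [simp]: "1 \<le> num S \<Longrightarrow> wf_mil S MTop"
  by (auto simp: MBot_def MTop_def all_vars_def)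

lemma wf_MConj [simp]: "1 \<le> num S \<Longrightarrow> wf_mil S (MConj \<phi>s) \<longleftrightarrow> (\<forall>\<phi>\<in>set \<phi>s. wf_mil S \<phi>)"
  by (induction \<phi>s) (auto simp: MConj_def)

lemma wf_MDisj [simp]: "1 \<le> num S \<Longrightarrow> wf_mil S (MDisj \<phi>s) \<longleftrightarrow> (\<forall>\<phi>\<in>set \<phi>s. wf_mil S \<phi>)"
  by (induction \<phi>s) (auto simp: MDisj_def)


subsection \<open>Satisfaction, monotonicity and minimal models\<close>

text \<open>Quantifiers over sort \<open>k\<close> never leave \<open>{1..insts S k}\<close>, so
  once the free variables are in range, predicates are only queried at indices of their own sort.
  Agreement there is enough, although the universe of a structure may be larger.\<close>

lemma sat_cong:
  assumes "wf_mil S \<phi>"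
    and "\<And>i. i \<in> fv \<phi> \<Longrightarrow> \<nu> i = \<mu> i \<and> \<nu> i \<in> {1..insts S (sort_of i)}"
    and "\<And>k q a. \<lbrakk>k \<in> {1..num S}; q \<in> preds_of S k; a \<in> {1..insts S k}\<rbrakk> \<Longrightarrow> a \<in> \<iota> q \<longleftrightarrow> a \<in> \<kappa> q"
  shows "sat (insts S) \<nu> \<iota> \<phi> = sat (insts S) \<mu> \<kappa> \<phi>"
  using assms(1,2)
proof (induction \<phi> arbitrary: \<nu> \<mu>)
  case (MPred q i)
  then show ?case
    using assms(3)[of "sort_of i" q "\<nu> i"] by (auto simp: all_vars_def)
next
  case (MAnd \<phi> \<psi>)
  have "sat (insts S) \<nu> \<iota> \<phi> = sat (insts S) \<mu> \<kappa> \<phi>" "sat (insts S) \<nu> \<iota> \<psi> = sat (insts S) \<mu> \<kappa> \<psi>"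
    using MAnd.prems by (intro MAnd.IH; simp)+
  then show ?case
    by simp
next
  case (MNeg \<phi>)
  then have "sat (insts S) \<nu> \<iota> \<phi> = sat (insts S) \<mu> \<kappa> \<phi>"
    by auto
  then show ?case
    by simp
next
  case (MEx i \<phi>)
  have "sat (insts S) (\<nu>(i := a)) \<iota> \<phi> = sat (insts S) (\<mu>(i := a)) \<kappa> \<phi>"
    if "a \<in> {1..insts S (sort_of i)}" for a
  proof (rule MEx.IH)
    show "(\<nu>(i := a)) j = (\<mu>(i := a)) j \<and> (\<nu>(i := a)) j \<in> {1..insts S (sort_of j)}"
      if "j \<in> fv \<phi>" for j
      using MEx.prems(2)[of j] \<open>a \<in> {1..insts S (sort_of i)}\<close> that by (cases "j = i") simp_all
  qed (use MEx.prems in simp)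
  then show ?case
    by auto
qed auto

text \<open>Without free variables the range condition is vacuous, so the two assignments are
  arbitrary and may even take the value \<open>0\<close>.\<close>

lemma sat_sentence_cong:
  assumes "mil_sentence S \<phi>"
    and "\<And>k q a. \<lbrakk>k \<in> {1..num S}; q \<in> preds_of S k; a \<in> {1..insts S k}\<rbrakk> \<Longrightarrow> a \<in> \<iota> q \<longleftrightarrow> a \<in> \<kappa> q"
  shows "sat (insts S) \<nu> \<iota> \<phi> = sat (insts S) \<mu> \<kappa> \<phi>"
  by (rule sat_cong) (use assms in \<open>auto simp: mil_sentence_def\<close>)

text \<open>Negation exchanges monotone and antitone, so both are proved in one induction: for
  \<open>b = False\<close> the conditionals swap \<open>\<iota>\<close> and
  \<open>\<kappa>\<close>.\<close>

lemma sat_mono_polarity: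
  assumes "polarity b \<phi>" "wf_mil S \<phi>" "\<And>q. q \<in> all_preds S \<Longrightarrow> \<iota> q \<subseteq> \<kappa> q"
  shows "sat M \<nu> (if b then \<iota> else \<kappa>) \<phi> \<Longrightarrow> sat M \<nu> (if b then \<kappa> else \<iota>) \<phi>"
  using assms(1,2)
proof (induction \<phi> arbitrary: \<nu> b)
  case (MPred q i)
  then have "q \<in> all_preds S"
    by (auto simp: all_preds_def all_vars_def)
  from assms(3)[OF this] MPred show ?case
    by auto
next
  case (MAnd \<phi> \<psi>)
  then show ?case
    unfolding sat.simps polarity.simps wf_mil.simps by blast
next
  case (MNeg \<phi>)
  have "sat M \<nu> (if \<not> b then \<iota> else \<kappa>) \<phi> \<Longrightarrow> sat M \<nu> (if \<not> b then \<kappa> else \<iota>) \<phi>"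
    by (rule MNeg.IH) (use MNeg.prems in simp_all)
  with MNeg.prems(1) show ?case
    by (cases b) auto
next
  case (MEx i \<phi>)
  then show ?case
    unfolding sat.simps polarity.simps wf_mil.simps by blast
qed simp

lemma sat_mono:
  assumes "positive \<phi>" "wf_mil S \<phi>" "\<And>q. q \<in> all_preds S \<Longrightarrow> \<iota> q \<subseteq> \<kappa> q" "sat M \<nu> \<iota> \<phi>"
  shows "sat M \<nu> \<kappa> \<phi>"
  using sat_mono_polarity[of True \<phi> S \<iota> \<kappa> M \<nu>] assms by (simp add: positive_def)

section \<open>Minimal models and positivation\<close>

lemma struct_le_trans: "\<lbrakk>struct_le S I J; struct_le S J K\<rbrakk> \<Longrightarrow> struct_le S I K"
  unfolding struct_le_def by blast

text \<open>Finitely many predicates over a finite universe give an interpretation a total size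
  \<open>m\<close>. A model of least size among those below \<open>I\<close> is minimal, since a
  model strictly below it is again below \<open>I\<close> and strictly smaller.\<close>

lemma ex_min_model_le:
  assumes "finite (all_preds S)" "I \<in> models S \<phi>"
  obtains J where "J \<in> min_models S \<phi>" "struct_le S J I"
proof -
  define m where "m J = (\<Sum>q\<in>all_preds S. card (snd J q))" for J :: "('a, 'b) struct"
  have "\<exists>J. (J \<in> models S \<phi> \<and> struct_le S J I) \<and>
      (\<forall>K. K \<in> models S \<phi> \<and> struct_le S K I \<longrightarrow> m J \<le> m K)"
    by (rule ex_has_least_nat[of _ I]) (use assms(2) in \<open>auto simp: struct_le_def\<close>)
  then obtain J where J: "J \<in> models S \<phi>" "struct_le S J I"
    and least: "\<And>K. \<lbrakk>K \<in> models S \<phi>; struct_le S K I\<rbrakk> \<Longrightarrow> m J \<le> m K"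
    by blast
  have "m K < m J" if K: "K \<in> models S \<phi>" "struct_le S K J" "\<not> struct_le S J K" for K
  proof -
    have fin: "finite (snd J q)" if "q \<in> all_preds S" for q
    proof (rule finite_subset)
      show "snd J q \<subseteq> univ S"
        using J(1) PiE_mem[OF _ that, of "snd J" "\<lambda>_. Pow (univ S)"]
        by (auto simp: models_def structs_def)
    qed (simp add: univ_def)
    from K(3) obtain q where q: "q \<in> all_preds S" "\<not> snd J q \<subseteq> snd K q"
      by (auto simp: struct_le_def)
    show ?thesis
      unfolding m_def
    proof (rule sum_strict_mono_ex1[OF assms(1)])
      show "\<forall>q\<in>all_preds S. card (snd K q) \<le> card (snd J q)"
        using K(2) fin by (auto simp: struct_le_def intro: card_mono)
      show "\<exists>q\<in>all_preds S. card (snd K q) < card (snd J q)"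
        using K(2) fin q by (intro bexI[of _ q] psubset_card_mono) (auto simp: struct_le_def)
    qed
  qed
  then have "\<not> (\<exists>K\<in>models S \<phi>. struct_le S K J \<and> \<not> struct_le S J K)"
    using least struct_le_trans[OF _ J(2)] by (meson not_le)
  with J(1) have "J \<in> min_models S \<phi>"
    by (simp add: min_models_def)
  from this J(2) show thesis
    by (rule that)
qed

text \<open>Models of a positive sentence are closed upwards, and every model lies above a minimal
  one. With common minimal models, the models of \<open>pos \<phi>\<close> form the upward closure
  of those of \<open>\<phi>\<close>.\<close>

lemma sat_positivation_iff:
  assumes "finite (all_preds S)" "positivation S pos" "mil_sentence S \<phi>" "(\<nu>, \<iota>) \<in> structs S"
  shows "sat (insts S) \<nu> \<iota> (pos \<phi>) \<longleftrightarrow> (\<exists>J\<in>models S \<phi>. struct_le S J (\<nu>, \<iota>))"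
proof
  from assms have pos: "mil_sentence S (pos \<phi>)" "positive (pos \<phi>)"
    and mins: "min_models S \<phi> = min_models S (pos \<phi>)"
    by (auto simp: positivation_def min_equiv_def)
  show "\<exists>J\<in>models S \<phi>. struct_le S J (\<nu>, \<iota>)" if "sat (insts S) \<nu> \<iota> (pos \<phi>)"
  proof -
    from that assms(4) have "(\<nu>, \<iota>) \<in> models S (pos \<phi>)"
      by (simp add: models_def)
    from ex_min_model_le[OF assms(1) this] show ?thesis
      unfolding mins[symmetric] by (auto simp: min_models_def)
  qed
  show "sat (insts S) \<nu> \<iota> (pos \<phi>)" if "\<exists>J\<in>models S \<phi>. struct_le S J (\<nu>, \<iota>)"
  proof -
    from that obtain J where "J \<in> models S \<phi>" "struct_le S J (\<nu>, \<iota>)"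
      by blast
    then obtain K where K: "K \<in> min_models S \<phi>" "struct_le S K (\<nu>, \<iota>)"
      using ex_min_model_le[OF assms(1)] struct_le_trans by metis
    then have "sat (insts S) (fst K) (snd K) (pos \<phi>)"
      unfolding mins by (auto simp: min_models_def models_def)
    \<comment> \<open>\<open>struct_le\<close> compares interpretations only, so \<open>K\<close>
      may carry another assignment; for a sentence it can be exchanged for
      \<open>\<nu>\<close>.\<close>
    then have "sat (insts S) \<nu> (snd K) (pos \<phi>)"
      using sat_sentence_cong[OF pos(1)] by blast
    then show ?thesis
      using sat_mono[OF pos(2), of S "snd K" \<iota>] pos(1) K(2) by (auto simp: mil_sentence_def struct_le_def)
  qed
qed


subsection \<open>The unfolded dual is the negation over the complemented valuation\<close>

text \<open>De Morgan: \<open>dual\<close> swaps connectives and quantifiers and negates equalities,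
  while complementing \<open>\<beta>\<close> negates the atoms that \<open>dual\<close> leaves
  alone. For \<open>b = False\<close>, \<open>nnf\<close> already negates, and the two negations
  cancel. The polarity assumption excludes the unspecified value of \<open>nnf\<close>.\<close>

lemma beval_unfold_dual_nnf:
  assumes "polarity b \<phi>"
  shows "beval \<beta> (unfold_env M e (dual (nnf b \<phi>))) \<longleftrightarrow>
    (sat M e (\<lambda>q. {a. \<not> \<beta> (q, a)}) \<phi> \<longleftrightarrow> \<not> b)"
  using assms
proof (induction \<phi> arbitrary: b e)
  case (MAnd \<phi> \<psi>)
  then show ?case
    using MAnd.IH(1)[of b e] MAnd.IH(2)[of b e] by auto
next
  case (MEx i \<phi>)
  then have "beval \<beta> (unfold_env M (e(i := a)) (dual (nnf b \<phi>))) \<longleftrightarrow>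
      (sat M (e(i := a)) (\<lambda>q. {a. \<not> \<beta> (q, a)}) \<phi> \<longleftrightarrow> \<not> b)" for a
    by (simp del: fun_upd_apply)
  then show ?case
    by (auto simp: fset_of_list.rep_eq atLeastLessThanSuc_atLeastAtMost simp del: fun_upd_apply)
qed (auto simp: BTop_def BBot_def)


subsection \<open>Traps and the formulae of a parametric system\<close>

context
  fixes S :: "('p, 's) system"
  assumes ps: "parametric_system S"
begin

section \<open>Consequences of the well-formedness of the system\<close>

lemma num_pos [simp]: "Suc 0 \<le> num S"
  using ps by (auto simp: parametric_system_def)

lemma component_type_ctype: "k \<in> {1..num S} \<Longrightarrow> component_type (ctype S k)"
  using ps by (simp add: parametric_system_def)

lemma finite_all_preds: "finite (all_preds S)"
  using component_type_ctype by (auto simp: all_preds_def preds_of_def component_type_def)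

lemma ports_sort_unique:
  "\<lbrakk>k \<in> {1..num S}; l \<in> {1..num S}; p \<in> ports (ctype S k); p \<in> ports (ctype S l)\<rbrakk> \<Longrightarrow> k = l"
  using ps unfolding parametric_system_def by blast

lemma states_sort_unique:
  "\<lbrakk>k \<in> {1..num S}; l \<in> {1..num S}; s \<in> states (ctype S k); s \<in> states (ctype S l)\<rbrakk> \<Longrightarrow> k = l"
  using ps unfolding parametric_system_def by blast

lemma trans_wf:
  assumes "k \<in> {1..num S}" "(s, p, s') \<in> trans (ctype S k)"
  shows "s \<in> states (ctype S k)" "p \<in> ports (ctype S k)" "s' \<in> states (ctype S k)"
  using component_type_ctype[OF assms(1)] assms(2) by (auto simp: component_type_def)

lemma trans_unique:
  "\<lbrakk>k \<in> {1..num S}; (s, p, s') \<in> trans (ctype S k); (r, p, r') \<in> trans (ctype S k)\<rbrakk> \<Longrightarrow> s = r \<and> s' = r'"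
  using component_type_ctype unfolding component_type_def by blast

lemma insts_subset_univ: "k \<in> {1..num S} \<Longrightarrow> {1..insts S k} \<subseteq> univ S"
  by (auto simp: univ_def intro: le_trans[OF _ Max_ge])

text \<open>Provides the assignment that turns an interpretation into a structure. Some type has an
  instance, so \<open>1\<close> lies in the universe.\<close>

lemma ex_assignment: "\<exists>\<nu>. \<nu> \<in> all_vars S \<rightarrow>\<^sub>E univ S"
proof -
  from ps obtain k where k: "k \<in> {1..num S}" "1 \<le> insts S k"
    by (auto simp: parametric_system_def)
  then have "1 \<in> univ S"
    using insts_subset_univ[OF k(1)] by auto
  then have "(\<lambda>i\<in>all_vars S. 1) \<in> all_vars S \<rightarrow>\<^sub>E univ S"
    by auto
  then show ?thesis
    by (rule exI[where P = "\<lambda>\<nu>. \<nu> \<in> all_vars S \<rightarrow>\<^sub>E univ S"])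
qed

lemma sentence_clause_mil: "c \<in> set (gamma S) \<Longrightarrow> mil_sentence S (clause_mil c :: ('p, 's) mil)"
  using ps by (simp add: parametric_system_def)

lemma clause_wf:
  assumes "c \<in> set (gamma S)"
  shows "\<forall>(p, i)\<in>set (rdv c). wf_mil S (MPred (Port p) i :: ('p, 's) mil)"
    and "\<forall>(i, \<psi>, p)\<in>set (bcast c). wf_mil S (eq_conj \<psi> :: ('p, 's) mil) \<and> wf_mil S (MPred (Port p) i :: ('p, 's) mil)"
    and "wf_mil S (eq_conj (guard c) :: ('p, 's) mil)"
  using sentence_clause_mil[OF assms]
  by (auto simp: mil_sentence_def clause_mil_def simp del: split_paired_All)

text \<open>Read off the closedness of the disjunct: outside its broadcast quantifiers only the
  rendezvous variables are bound.\<close>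

lemma clause_fv:
  assumes "c \<in> set (gamma S)"
  shows "\<forall>(i, \<psi>, p)\<in>set (bcast c). fv (eq_conj \<psi> :: ('p, 's) mil) \<subseteq> insert i (snd ` set (rdv c))"
    and "fv (eq_conj (guard c) :: ('p, 's) mil) \<subseteq> snd ` set (rdv c)"
proof -
  note c = sentence_clause_mil[OF assms, unfolded mil_sentence_def clause_mil_def]
  show "fv (eq_conj (guard c) :: ('p, 's) mil) \<subseteq> snd ` set (rdv c)"
    using c by auto
  from c have "fv ((case x of (i, \<psi>, p) \<Rightarrow> MAll i (MImp (eq_conj \<psi>) (MPred (Port p) i))) :: ('p, 's) mil)
      \<subseteq> snd ` set (rdv c)" if "x \<in> set (bcast c)" for x
    using that by auto
  then show "\<forall>(i, \<psi>, p)\<in>set (bcast c). fv (eq_conj \<psi> :: ('p, 's) mil) \<subseteq> insert i (snd ` set (rdv c))"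
    by fastforce
qed

lemma rdv_wf:
  assumes "c \<in> set (gamma S)" "(p, i) \<in> set (rdv c)"
  shows "sort_of i \<in> {1..num S}" "p \<in> ports (ctype S (sort_of i))"
  using clause_wf(1)[OF assms(1)] assms(2) by (auto simp: all_vars_def preds_of_def)

lemma bcast_wf:
  assumes "c \<in> set (gamma S)" "(i, \<psi>, p) \<in> set (bcast c)"
  shows "sort_of i \<in> {1..num S}" "p \<in> ports (ctype S (sort_of i))"
  using clause_wf(2)[OF assms(1)] assms(2) by (auto simp: all_vars_def preds_of_def)

section \<open>Source and target states of a port\<close>

lemma pre_port_eq:
  assumes "sort_of i \<in> {1..num S}" "(s, p, s') \<in> trans (ctype S (sort_of i))"
  shows "pre_port S p i = MPred (State s) i"
proof -
  \<comment> \<open>At most one transition of a component type carries \<open>p\<close>, so the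
    description denotes its source.\<close>
  have "(THE s. \<exists>s'. (s, p, s') \<in> trans (ctype S (sort_of i))) = s"
    using trans_unique[OF assms(1)] assms(2) by blast
  then show ?thesis
    using assms(2) unfolding pre_port_def by auto
qed

text \<open>The existential form hides the definite description and also covers a port without
  transition, where \<open>MBot\<close> is false and no witness exists.\<close>

lemma sat_pre_port:
  assumes "sort_of i \<in> {1..num S}"
  shows "sat M \<nu> \<iota> (pre_port S p i) \<longleftrightarrow>
    (\<exists>s s'. (s, p, s') \<in> trans (ctype S (sort_of i)) \<and> \<nu> i \<in> \<iota> (State s))"
proof (cases "\<exists>s s'. (s, p, s') \<in> trans (ctype S (sort_of i))")
  case True
  then obtain s s' where s: "(s, p, s') \<in> trans (ctype S (sort_of i))"
    by blast
  have "(\<exists>s s'. (s, p, s') \<in> trans (ctype S (sort_of i)) \<and> \<nu> i \<in> \<iota> (State s)) \<longleftrightarrow> \<nu> i \<in> \<iota> (State s)"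
    using s trans_unique[OF assms] by metis
  then show ?thesis
    by (simp add: pre_port_eq[OF assms s])
next
  case False
  then have "pre_port S p i = MBot"
    unfolding pre_port_def by (rule if_not_P)
  with False show ?thesis
    by (metis sat_MBot)
qed

lemma wf_pre_port:
  assumes "sort_of i \<in> {1..num S}"
  shows "wf_mil S (pre_port S p i)"
proof (cases "\<exists>s s'. (s, p, s') \<in> trans (ctype S (sort_of i))")
  case True
  then obtain s s' where s: "(s, p, s') \<in> trans (ctype S (sort_of i))"
    by blast
  show ?thesis
    using trans_wf[OF assms s] assms by (simp add: pre_port_eq[OF assms s] all_vars_def preds_of_def)
next
  case False
  then have "pre_port S p i = MBot"
    unfolding pre_port_def by (rule if_not_P)
  then show ?thesis
    by simp
qed

lemma post_port_eq:
  assumes "sort_of i \<in> {1..num S}" "(s, p, s') \<in> trans (ctype S (sort_of i))"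
  shows "post_port S p i = MPred (State s') i"
proof -
  have "(THE s'. \<exists>s. (s, p, s') \<in> trans (ctype S (sort_of i))) = s'"
    using trans_unique[OF assms(1)] assms(2) by blast
  then show ?thesis
    using assms(2) unfolding post_port_def by auto
qed

lemma sat_post_port:
  assumes "sort_of i \<in> {1..num S}"
  shows "sat M \<nu> \<iota> (post_port S p i) \<longleftrightarrow>
    (\<exists>s s'. (s, p, s') \<in> trans (ctype S (sort_of i)) \<and> \<nu> i \<in> \<iota> (State s'))"
proof (cases "\<exists>s s'. (s, p, s') \<in> trans (ctype S (sort_of i))")
  case True
  then obtain s s' where s: "(s, p, s') \<in> trans (ctype S (sort_of i))"
    by blast
  have "(\<exists>s s'. (s, p, s') \<in> trans (ctype S (sort_of i)) \<and> \<nu> i \<in> \<iota> (State s')) \<longleftrightarrow> \<nu> i \<in> \<iota> (State s')"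
    using s trans_unique[OF assms] by metis
  then show ?thesis
    by (simp add: post_port_eq[OF assms s])
next
  case False
  then have "post_port S p i = MBot"
    unfolding post_port_def by (rule if_not_P)
  with False show ?thesis
    by (metis sat_MBot)
qed

lemma wf_post_port:
  assumes "sort_of i \<in> {1..num S}"
  shows "wf_mil S (post_port S p i)"
proof (cases "\<exists>s s'. (s, p, s') \<in> trans (ctype S (sort_of i))")
  case True
  then obtain s s' where s: "(s, p, s') \<in> trans (ctype S (sort_of i))"
    by blast
  show ?thesis
    using trans_wf[OF assms s] assms by (simp add: post_port_eq[OF assms s] all_vars_def preds_of_def)
next
  case False
  then have "post_port S p i = MBot"
    unfolding post_port_def by (rule if_not_P)
  then show ?thesis
    by simp
qed

lemma fv_pre_port: "fv (pre_port S p i) \<subseteq> {i}"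
  and fv_post_port: "fv (post_port S p i) \<subseteq> {i}"
  by (auto simp: pre_port_def post_port_def)

text \<open>Each \<open>pre_port\<close> or \<open>post_port\<close> mentions at most its own
  variable, which is bound by the outer universal block for a rendezvous and by the inner
  existential for a broadcast.\<close>

lemma sentence_clause_trap:
  assumes "c \<in> set (gamma S)"
  shows "mil_sentence S (clause_trap S c)"
proof -
  have rdv: "wf_mil S (pre_port S p i) \<and> wf_mil S (post_port S p i) \<and> i \<in> all_vars S"
    if "(p, i) \<in> set (rdv c)" for p i
    using rdv_wf[OF assms that] wf_pre_port wf_post_port by (simp add: all_vars_def)
  have bcast: "wf_mil S (eq_conj \<psi> :: ('p, 's) mil) \<and> wf_mil S (pre_port S p i) \<and>
      wf_mil S (post_port S p i) \<and> i \<in> all_vars S" if "(i, \<psi>, p) \<in> set (bcast c)" for i \<psi> p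
    using bcast_wf[OF assms that] bspec[OF clause_wf(2)[OF assms] that] wf_pre_port wf_post_port
    by (simp add: all_vars_def)
  have "wf_mil S (clause_trap S c)"
    using rdv bcast clause_wf(3)[OF assms]
    by (auto simp: clause_trap_def simp del: split_paired_All)
  moreover have "fv (clause_trap S c) = {}"
  proof -
    \<comment> \<open>\<open>F\<close> stands for \<open>pre_port S\<close> and
      \<open>post_port S\<close> alike, so that one argument serves premise and conclusion of the
      trap clause.\<close>
    have rdv: "fv (MDisj (map (\<lambda>(p, i). F p i) (rdv c))) \<subseteq> snd ` set (rdv c)"
      if F: "\<And>p i. fv (F p i) \<subseteq> {i}" for F :: "'p \<Rightarrow> ivar \<Rightarrow> ('p, 's) mil"
    proof -
      have "fv (case x of (p, i) \<Rightarrow> F p i) \<subseteq> {snd x}" for x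
        using F by (cases x) simp
      then show ?thesis
        unfolding fv_MDisj set_map by blast
    qed
    have bcast: "fv (MDisj (map (\<lambda>(i, \<psi>, p). MEx i (MAnd (eq_conj \<psi>) (F p i))) (bcast c)))
        \<subseteq> snd ` set (rdv c)"
      if F: "\<And>p i. fv (F p i) \<subseteq> {i}" for F :: "'p \<Rightarrow> ivar \<Rightarrow> ('p, 's) mil"
    proof -
      have "fv (case x of (i, \<psi>, p) \<Rightarrow> MEx i (MAnd (eq_conj \<psi>) (F p i))) \<subseteq> snd ` set (rdv c)"
        if x: "x \<in> set (bcast c)" for x
      proof -
        obtain i \<psi> p where x_eq: "x = (i, \<psi>, p)"
          by (rule prod_cases3)
        show ?thesis
          using bspec[OF clause_fv(1)[OF assms] x] F[of p i] unfolding x_eq prod.case fv.simps by blast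
      qed
      then show ?thesis
        by (simp add: UN_subset_iff)
    qed
    show ?thesis
      using clause_fv(2)[OF assms] rdv[of "pre_port S"] bcast[of "pre_port S"]
        rdv[of "post_port S"] bcast[of "post_port S"] fv_pre_port fv_post_port
      unfolding clause_trap_def fv_MAlls fv_MImp fv_MOr fv.simps(3) set_map Diff_eq_empty_iff Un_subset_iff
      by blast
  qed
  ultimately show ?thesis
    by (simp add: mil_sentence_def)
qed

lemma sentence_trap_mil: "mil_sentence S (trap_mil S)"
  using sentence_clause_trap by (auto simp: trap_mil_def mil_sentence_def)

lemma sentence_init_mil: "mil_sentence S (init_mil S)"
  using component_type_ctype
  by (auto simp: init_mil_def mil_sentence_def all_vars_def preds_of_def component_type_def)

section \<open>Interactions of a disjunct under its admissible assignments\<close>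

definition guarded :: "'p clause \<Rightarrow> (ivar \<Rightarrow> nat) \<Rightarrow> (ivar \<Rightarrow> nat) set" where
  "guarded c \<nu> = {\<mu> \<in> reassign (insts S) (snd ` set (rdv c)) \<nu>. \<forall>l\<in>set (guard c). eqlit_holds \<mu> l}"

lemma rdv_interaction: "(p, i) \<in> set (rdv c) \<Longrightarrow> (p, \<mu> i) \<in> clause_interaction S c \<mu>"
  unfolding clause_interaction_def by blast

lemma bcast_interaction:
  "\<lbrakk>(i, \<psi>, p) \<in> set (bcast c); a \<in> {1..insts S (sort_of i)}; \<forall>l\<in>set \<psi>. eqlit_holds (\<mu>(i := a)) l\<rbrakk>
    \<Longrightarrow> (p, a) \<in> clause_interaction S c \<mu>"
  unfolding clause_interaction_def sat_eq_conj by blast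

lemma clause_interactionE:
  assumes "(p, a) \<in> clause_interaction S c \<mu>"
  obtains (rdv) i where "(p, i) \<in> set (rdv c)" "a = \<mu> i"
  | (bcast) i \<psi> where "(i, \<psi>, p) \<in> set (bcast c)" "a \<in> {1..insts S (sort_of i)}"
      "\<forall>l\<in>set \<psi>. eqlit_holds (\<mu>(i := a)) l"
  using assms unfolding clause_interaction_def sat_eq_conj by blast

lemma guarded_rdv_range: "\<lbrakk>\<mu> \<in> guarded c \<nu>; (p, i) \<in> set (rdv c)\<rbrakk> \<Longrightarrow> \<mu> i \<in> {1..insts S (sort_of i)}"
  by (force simp: guarded_def reassign_def)

lemma clause_interaction_wf:
  assumes c: "c \<in> set (gamma S)" and \<mu>: "\<mu> \<in> guarded c \<nu>" and pa: "(p, a) \<in> clause_interaction S c \<mu>"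
  shows "\<exists>k\<in>{1..num S}. p \<in> ports (ctype S k) \<and> a \<in> {1..insts S k}"
  using pa
proof (cases rule: clause_interactionE)
  case (rdv i)
  then show ?thesis
    using rdv_wf[OF c rdv(1)] guarded_rdv_range[OF \<mu> rdv(1)] by blast
next
  case (bcast i \<psi>)
  then show ?thesis
    using bcast_wf[OF c bcast(1)] by blast
qed

text \<open>The rendezvous atoms and the broadcast implications together say that every pair of the
  interaction holds in \<open>\<iota>\<close>. So the models of a disjunct are the structures that
  contain one of its interactions.\<close>

lemma sat_clause_mil:
  "sat (insts S) \<nu> \<iota> (clause_mil c) \<longleftrightarrow>
    (\<exists>\<mu>\<in>guarded c \<nu>. \<forall>(p, a)\<in>clause_interaction S c \<mu>. a \<in> \<iota> (Port p))"
proof -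
  have "sat (insts S) \<mu> \<iota> (MAnd (MConj (map (\<lambda>(p, i). MPred (Port p) i) (rdv c)))
        (MConj (map (\<lambda>(i, \<psi>, p). MAll i (MImp (eq_conj \<psi>) (MPred (Port p) i))) (bcast c)))) \<longleftrightarrow>
      (\<forall>(p, a)\<in>clause_interaction S c \<mu>. a \<in> \<iota> (Port p))" (is "?L \<longleftrightarrow> ?R") for \<mu>
  proof -
    have "?L \<longleftrightarrow> (\<forall>(p, i)\<in>set (rdv c). \<mu> i \<in> \<iota> (Port p)) \<and>
        (\<forall>(i, \<psi>, p)\<in>set (bcast c). \<forall>a\<in>{1..insts S (sort_of i)}.
          (\<forall>l\<in>set \<psi>. eqlit_holds (\<mu>(i := a)) l) \<longrightarrow> a \<in> \<iota> (Port p))"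
      by (simp add: split_beta del: atLeastAtMost_iff)
    also have "\<dots> \<longleftrightarrow> ?R"
      using rdv_interaction bcast_interaction
      by (fast elim: clause_interactionE)
    finally show ?thesis .
  qed
  then show ?thesis
    unfolding clause_mil_def sat_MExs guarded_def sat.simps(3) sat_eq_conj set_map by blast
qed

text \<open>Treats source and target states uniformly: \<open>F\<close> is either port formula and
  \<open>G\<close> its truth condition. Since different types share no ports, \<open>k\<close> on
  the right can only be the sort of the variable that contributed the pair.\<close>

lemma sat_port_disj:
  fixes F :: "'p \<Rightarrow> ivar \<Rightarrow> ('p, 's) mil" and G :: "'p \<Rightarrow> nat \<Rightarrow> nat \<Rightarrow> bool"
  assumes c: "c \<in> set (gamma S)" and \<mu>: "\<mu> \<in> guarded c \<nu>"
    and F: "\<And>\<mu> p i. sort_of i \<in> {1..num S} \<Longrightarrow> sat (insts S) \<mu> \<iota> (F p i) \<longleftrightarrow> G p (sort_of i) (\<mu> i)"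
    and G: "\<And>p k a. \<lbrakk>k \<in> {1..num S}; G p k a\<rbrakk> \<Longrightarrow> p \<in> ports (ctype S k)"
  shows "sat (insts S) \<mu> \<iota>
      (MOr (MDisj (map (\<lambda>(p, i). F p i) (rdv c)))
        (MDisj (map (\<lambda>(i, \<psi>, p). MEx i (MAnd (eq_conj \<psi>) (F p i))) (bcast c)))) \<longleftrightarrow>
    (\<exists>(p, a)\<in>clause_interaction S c \<mu>. \<exists>k\<in>{1..num S}. a \<in> {1..insts S k} \<and> G p k a)"
    (is "?L \<longleftrightarrow> ?R")
proof -
  have L: "?L \<longleftrightarrow> (\<exists>(p, i)\<in>set (rdv c). sat (insts S) \<mu> \<iota> (F p i)) \<or>
      (\<exists>(i, \<psi>, p)\<in>set (bcast c). \<exists>a\<in>{1..insts S (sort_of i)}.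
        (\<forall>l\<in>set \<psi>. eqlit_holds (\<mu>(i := a)) l) \<and> sat (insts S) (\<mu>(i := a)) \<iota> (F p i))"
    by (simp add: split_beta del: atLeastAtMost_iff)
  show ?thesis
  proof
    assume ?L
    then consider (rdv) p i where "(p, i) \<in> set (rdv c)" "sat (insts S) \<mu> \<iota> (F p i)"
      | (bcast) i \<psi> p a where "(i, \<psi>, p) \<in> set (bcast c)" "a \<in> {1..insts S (sort_of i)}"
        "\<forall>l\<in>set \<psi>. eqlit_holds (\<mu>(i := a)) l" "sat (insts S) (\<mu>(i := a)) \<iota> (F p i)"
      unfolding L by blast
    then show ?R
    proof cases
      case rdv
      then show ?R
        using F[of i \<mu> p] rdv_wf[OF c rdv(1)] guarded_rdv_range[OF \<mu> rdv(1)] rdv_interaction[OF rdv(1)]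
        by blast
    next
      case bcast
      then have "(p, a) \<in> clause_interaction S c \<mu>"
        by (intro bcast_interaction)
      moreover have "G p (sort_of i) a"
        using F[of i "\<mu>(i := a)" p] bcast(4) bcast_wf[OF c bcast(1)] by simp
      ultimately show ?R
        using bcast(2) bcast_wf[OF c bcast(1)] by blast
    qed
  next
    assume ?R
    then obtain p a k where pa: "(p, a) \<in> clause_interaction S c \<mu>" "k \<in> {1..num S}" "G p k a"
      by blast
    from pa(1) show ?L
    proof (cases rule: clause_interactionE)
      case (rdv i)
      have "k = sort_of i"
        using ports_sort_unique[OF pa(2) _ G[OF pa(2,3)]] rdv_wf[OF c rdv(1)] by blast
      with rdv pa F[of i \<mu> p] have "sat (insts S) \<mu> \<iota> (F p i)"
        by simp
      with rdv(1) show ?thesis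
        unfolding L by blast
    next
      case (bcast i \<psi>)
      have "k = sort_of i"
        using ports_sort_unique[OF pa(2) _ G[OF pa(2,3)]] bcast_wf[OF c bcast(1)] by blast
      with bcast pa F[of i "\<mu>(i := a)" p] have "sat (insts S) (\<mu>(i := a)) \<iota> (F p i)"
        by simp
      with bcast show ?thesis
        unfolding L by blast
    qed
  qed
qed

text \<open>This is the trap condition for every admissible interaction, treated as if it were a
  transition of the net, whether or not it comes from a minimal model.\<close>

lemma sat_clause_trap:
  assumes "c \<in> set (gamma S)"
  shows "sat (insts S) \<nu> \<iota> (clause_trap S c) \<longleftrightarrow>
    (\<forall>\<mu>\<in>guarded c \<nu>.
      (\<exists>(p, a)\<in>clause_interaction S c \<mu>. \<exists>k\<in>{1..num S}. a \<in> {1..insts S k} \<and>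
        (\<exists>s s'. (s, p, s') \<in> trans (ctype S k) \<and> a \<in> \<iota> (State s))) \<longrightarrow>
      (\<exists>(p, a)\<in>clause_interaction S c \<mu>. \<exists>k\<in>{1..num S}. a \<in> {1..insts S k} \<and>
        (\<exists>s s'. (s, p, s') \<in> trans (ctype S k) \<and> a \<in> \<iota> (State s'))))"
proof -
  have disj: "sat (insts S) \<mu> \<iota>
      (MOr (MDisj (map (\<lambda>(p, i). F p i) (rdv c)))
        (MDisj (map (\<lambda>(i, \<psi>, p). MEx i (MAnd (eq_conj \<psi>) (F p i))) (bcast c)))) \<longleftrightarrow>
      (\<exists>(p, a)\<in>clause_interaction S c \<mu>. \<exists>k\<in>{1..num S}. a \<in> {1..insts S k} \<and> G p k a)"
    (is "?sat F \<mu> \<longleftrightarrow> ?int G \<mu>")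
    if "\<mu> \<in> guarded c \<nu>"
      "\<And>\<mu> p i. sort_of i \<in> {1..num S} \<Longrightarrow> sat (insts S) \<mu> \<iota> (F p i) \<longleftrightarrow> G p (sort_of i) (\<mu> i)"
      "\<And>p k a. \<lbrakk>k \<in> {1..num S}; G p k a\<rbrakk> \<Longrightarrow> p \<in> ports (ctype S k)"
    for F :: "'p \<Rightarrow> ivar \<Rightarrow> ('p, 's) mil" and G \<mu>
    using sat_port_disj[OF assms that] .
  let ?pre = "\<lambda>p k a. \<exists>s s'. (s, p, s') \<in> trans (ctype S k) \<and> a \<in> \<iota> (State s)"
  let ?post = "\<lambda>p k a. \<exists>s s'. (s, p, s') \<in> trans (ctype S k) \<and> a \<in> \<iota> (State s')"
  have "sat (insts S) \<nu> \<iota> (clause_trap S c) \<longleftrightarrow>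
      (\<forall>\<mu>\<in>guarded c \<nu>. ?sat (pre_port S) \<mu> \<longrightarrow> ?sat (post_port S) \<mu>)"
    unfolding clause_trap_def sat_MAlls sat_MImp sat.simps(3) sat_eq_conj guarded_def set_map
    by blast
  also have "\<dots> \<longleftrightarrow> (\<forall>\<mu>\<in>guarded c \<nu>. ?int ?pre \<mu> \<longrightarrow> ?int ?post \<mu>)"
  proof (intro ball_cong refl arg_cong2[where f = "(\<longrightarrow>)"])
    fix \<mu> assume \<mu>: "\<mu> \<in> guarded c \<nu>"
    show "?sat (pre_port S) \<mu> \<longleftrightarrow> ?int ?pre \<mu>"
      by (rule disj[OF \<mu> sat_pre_port]) (use trans_wf(2) in blast)+
    show "?sat (post_port S) \<mu> \<longleftrightarrow> ?int ?post \<mu>"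
      by (rule disj[OF \<mu> sat_post_port]) (use trans_wf(2) in blast)+
  qed
  finally show ?thesis .
qed

section \<open>Structures as sets of places, transitions as interactions\<close>

definition places_of :: "(('p, 's) pred \<Rightarrow> nat set) \<Rightarrow> ('s \<times> nat) set" where
  "places_of \<iota> = {(s, a) \<in> places (system_net S). a \<in> \<iota> (State s)}"

text \<open>Restricting a model to an interaction of a disjunct that it satisfies leaves a model.\<close>

lemma min_model_is_clause_interaction:
  assumes I: "(\<nu>, \<iota>) \<in> min_models S (interaction_mil (gamma S))"
  obtains c \<mu> where "c \<in> set (gamma S)" "\<mu> \<in> guarded c \<nu>"
    "struct_interaction S (\<nu>, \<iota>) = clause_interaction S c \<mu>"
proof -
  from I have str: "(\<nu>, \<iota>) \<in> structs S"
    and "sat (insts S) \<nu> \<iota> (interaction_mil (gamma S))"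
    by (auto simp: min_models_def models_def)
  then obtain c \<mu> where c: "c \<in> set (gamma S)" and \<mu>: "\<mu> \<in> guarded c \<nu>"
    and sub: "\<forall>(p, a)\<in>clause_interaction S c \<mu>. a \<in> \<iota> (Port p)"
    by (auto simp: interaction_mil_def sat_clause_mil)
  \<comment> \<open>The least interpretation that realizes the chosen interaction: state predicates
    become empty. The restriction to \<open>all_preds S\<close> makes it extensional, as
    \<open>structs\<close> demands.\<close>
  define \<kappa> where "\<kappa> = (\<lambda>q\<in>all_preds S. {a \<in> univ S. \<exists>p. q = Port p \<and> (p, a) \<in> clause_interaction S c \<mu>})"
  have CI: "Port p \<in> all_preds S \<and> a \<in> univ S" if "(p, a) \<in> clause_interaction S c \<mu>" for p a
    using clause_interaction_wf[OF c \<mu> that] insts_subset_univ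
    unfolding all_preds_def preds_of_def by blast
  have "(\<nu>, \<kappa>) \<in> models S (interaction_mil (gamma S))"
  proof -
    have "(\<nu>, \<kappa>) \<in> structs S"
      using str by (auto simp: structs_def \<kappa>_def)
    moreover have "sat (insts S) \<nu> \<kappa> (clause_mil c)"
      unfolding sat_clause_mil using CI by (intro bexI[OF _ \<mu>]) (auto simp: \<kappa>_def)
    ultimately show ?thesis
      using c by (auto simp: models_def interaction_mil_def)
  qed
  moreover have "struct_le S (\<nu>, \<kappa>) (\<nu>, \<iota>)"
    using sub by (auto simp: struct_le_def \<kappa>_def)
  \<comment> \<open>Minimality forbids a model strictly below \<open>\<iota>\<close>, so the two
    interpretations agree on all predicates.\<close>
  ultimately have "struct_le S (\<nu>, \<iota>) (\<nu>, \<kappa>)"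
    using I by (auto simp: min_models_def)
  then have "struct_interaction S (\<nu>, \<iota>) = clause_interaction S c \<mu>"
    using sub CI by (fastforce simp: struct_interaction_def struct_le_def \<kappa>_def)
  with c \<mu> show thesis
    by (rule that)
qed

lemma interaction_of_trans:
  assumes "k \<in> {1..num S}" "(s, p, s') \<in> trans (ctype S k)" "a \<in> snd I (Port p)"
  shows "(p, a) \<in> struct_interaction S I"
  using assms trans_wf(2)[OF assms(1,2)]
  by (auto simp: struct_interaction_def all_preds_def preds_of_def)

text \<open>State sets of different types are disjoint, so \<open>s\<close> determines its type and
  with it the bound on indices, which may lie below that of the universe.\<close>

lemma place_iff:
  assumes "k \<in> {1..num S}" "s \<in> states (ctype S k)"
  shows "(s, a) \<in> places (system_net S) \<longleftrightarrow> a \<in> {1..insts S k}"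
proof -
  have "(s, a) \<in> places (system_net S) \<longleftrightarrow>
      (\<exists>l\<in>{1..num S}. s \<in> states (ctype S l) \<and> a \<in> {1..insts S l})"
    by (simp add: system_net_def)
  then show ?thesis
    using assms states_sort_unique by blast
qed

lemma place_wf:
  assumes "(s, a) \<in> places (system_net S)"
  shows "State s \<in> all_preds S" "a \<in> univ S"
proof -
  from assms obtain k where k: "k \<in> {1..num S}" "s \<in> states (ctype S k)" "a \<in> {1..insts S k}"
    by (auto simp: system_net_def)
  from k(1,2) show "State s \<in> all_preds S"
    unfolding all_preds_def preds_of_def by blast
  from k(3) insts_subset_univ[OF k(1)] show "a \<in> univ S"
    by blast
qed

text \<open>A transition is itself an interaction of a disjunct, so the formula yields the trap
  property. Conversely an interaction need not be a transition, and \<open>cov\<close> supplies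
  transitions inside it.\<close>

lemma trap_places_of_iff:
  assumes cov: "interactions_covered S"
  shows "trap (system_net S) (places_of \<iota>) \<longleftrightarrow> sat (insts S) \<nu> \<iota> (trap_mil S)"
proof
  let ?N = "system_net S" and ?W = "places_of \<iota>"
  assume trap: "trap ?N ?W"
  have "sat (insts S) \<nu> \<iota> (clause_trap S c)" if c: "c \<in> set (gamma S)" for c
    unfolding sat_clause_trap[OF c]
  proof (intro ballI impI)
    fix \<mu> assume \<mu>: "\<mu> \<in> guarded c \<nu>"
    assume "\<exists>(p, a)\<in>clause_interaction S c \<mu>. \<exists>k\<in>{1..num S}. a \<in> {1..insts S k} \<and>
        (\<exists>s s'. (s, p, s') \<in> trans (ctype S k) \<and> a \<in> \<iota> (State s))"
    then obtain p a k s s' where pa: "(p, a) \<in> clause_interaction S c \<mu>"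
      and k: "k \<in> {1..num S}" "(s, p, s') \<in> trans (ctype S k)"
      and a: "a \<in> {1..insts S k}" "a \<in> \<iota> (State s)"
      by blast
    from k a have w: "(s, a) \<in> ?W"
      using place_iff[OF k(1) trans_wf(1)[OF k]] by (simp add: places_of_def)
    \<comment> \<open>One piece of the cover is enough: a transition containing
      \<open>(p, a)\<close> has \<open>(s, a)\<close> as an input place, and its output place in the
      trap stems from a pair of the same interaction.\<close>
    have "clause_interaction S c \<mu> =
        \<Union>{struct_interaction S I | I. I \<in> min_models S (interaction_mil (gamma S)) \<and>
          struct_interaction S I \<subseteq> clause_interaction S c \<mu>}"
      using cov c \<mu> unfolding interactions_covered_def guarded_def reassign_def by auto
    with pa obtain I where I: "I \<in> min_models S (interaction_mil (gamma S))"
      "struct_interaction S I \<subseteq> clause_interaction S c \<mu>" "(p, a) \<in> struct_interaction S I"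
      by blast
    obtain \<nu>' \<kappa> where I_eq: "I = (\<nu>', \<kappa>)"
      by force
    have "((s, a), I) \<in> in_edges ?N"
      using I k by (auto simp: system_net_def I_eq struct_interaction_def)
    with trap w I(1) obtain w' where w': "w' \<in> ?W" "(I, w') \<in> out_edges ?N"
      by (fastforce simp: trap_def system_net_def)
    then obtain r r' q b l where l: "w' = (r', b)" "l \<in> {1..num S}" "(r, q, r') \<in> trans (ctype S l)"
      "b \<in> \<kappa> (Port q)"
      by (auto simp: system_net_def I_eq)
    from w'(1) have "b \<in> {1..insts S l}" "b \<in> \<iota> (State r')"
      using place_iff[OF l(2) trans_wf(3)[OF l(2,3)]] by (auto simp: l(1) places_of_def)
    moreover have "(q, b) \<in> clause_interaction S c \<mu>"
      using I(2) interaction_of_trans[OF l(2,3), of b I] l(4) by (auto simp: I_eq)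
    ultimately show "\<exists>(p, a)\<in>clause_interaction S c \<mu>. \<exists>k\<in>{1..num S}. a \<in> {1..insts S k} \<and>
        (\<exists>s s'. (s, p, s') \<in> trans (ctype S k) \<and> a \<in> \<iota> (State s'))"
      using l by blast
  qed
  then show "sat (insts S) \<nu> \<iota> (trap_mil S)"
    by (simp add: trap_mil_def)
next
  let ?N = "system_net S" and ?W = "places_of \<iota>"
  assume sat: "sat (insts S) \<nu> \<iota> (trap_mil S)"
  show "trap ?N ?W"
    unfolding trap_def
  proof (intro conjI ballI impI)
    show "?W \<subseteq> places ?N"
      by (auto simp: places_of_def)
    fix I assume "I \<in> transitions ?N" and in_W: "\<exists>w\<in>?W. (w, I) \<in> in_edges ?N"
    then obtain \<nu>' \<kappa> where I_eq: "I = (\<nu>', \<kappa>)" and I: "(\<nu>', \<kappa>) \<in> min_models S (interaction_mil (gamma S))"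
      by (cases I) (auto simp: system_net_def)
    from in_W obtain s p s' a k where w: "(s, a) \<in> ?W" and k: "k \<in> {1..num S}" "(s, p, s') \<in> trans (ctype S k)"
      and a: "a \<in> \<kappa> (Port p)"
      by (auto simp: system_net_def I_eq)
    from w have a': "a \<in> {1..insts S k}" "a \<in> \<iota> (State s)"
      using place_iff[OF k(1) trans_wf(1)[OF k]] by (auto simp: places_of_def)
    from min_model_is_clause_interaction[OF I] obtain c \<mu> where c: "c \<in> set (gamma S)"
      and \<mu>: "\<mu> \<in> guarded c \<nu>'" and eq: "struct_interaction S (\<nu>', \<kappa>) = clause_interaction S c \<mu>" .
    \<comment> \<open>\<open>\<mu>\<close> is a reassignment of \<open>\<nu>'\<close>, which comes
      from the transition, and not of \<open>\<nu>\<close>; the clause is closed, so its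
      satisfaction transfers.\<close>
    have "sat (insts S) \<nu>' \<iota> (clause_trap S c)"
      using sat c sat_sentence_cong[OF sentence_clause_trap[OF c], of \<iota> \<iota> \<nu> \<nu>'] by (simp add: trap_mil_def)
    moreover have "(p, a) \<in> clause_interaction S c \<mu>"
      using interaction_of_trans[OF k, of a "(\<nu>', \<kappa>)"] a eq by simp
    ultimately have "\<exists>(p, a)\<in>clause_interaction S c \<mu>. \<exists>k\<in>{1..num S}. a \<in> {1..insts S k} \<and>
        (\<exists>s s'. (s, p, s') \<in> trans (ctype S k) \<and> a \<in> \<iota> (State s'))"
      unfolding sat_clause_trap[OF c] using \<mu> k a' by blast
    then obtain q b l r r' where q: "(q, b) \<in> clause_interaction S c \<mu>"
      and l: "l \<in> {1..num S}" "(r, q, r') \<in> trans (ctype S l)"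
      and b: "b \<in> {1..insts S l}" "b \<in> \<iota> (State r')"
      by blast
    have "(r', b) \<in> ?W"
      using b place_iff[OF l(1) trans_wf(3)[OF l]] by (simp add: places_of_def)
    moreover have "(I, (r', b)) \<in> out_edges ?N"
      using q l I by (auto simp: system_net_def I_eq eq[symmetric] struct_interaction_def)
    ultimately show "\<exists>w\<in>?W. (I, w) \<in> out_edges ?N"
      by blast
  qed
qed

text \<open>An initial state is a state of its type, so its instances are places and the restriction
  in \<open>places_of\<close> removes none of them.\<close>

lemma marked_places_of_iff:
  "marked (system_net S) (places_of \<iota>) \<longleftrightarrow> sat (insts S) \<nu> \<iota> (init_mil S)"
proof -
  have init: "init_marking (system_net S) (s, a) > 0 \<longleftrightarrow>
      (\<exists>k\<in>{1..num S}. s = init_state (ctype S k) \<and> a \<in> {1..insts S k})" for s a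
    by (simp add: system_net_def)
  have "marked (system_net S) (places_of \<iota>) \<longleftrightarrow> (\<exists>s a. (s, a) \<in> places (system_net S) \<and>
      a \<in> \<iota> (State s) \<and> init_marking (system_net S) (s, a) > 0)"
    by (auto simp: marked_def places_of_def)
  also have "\<dots> \<longleftrightarrow>
      (\<exists>s a. (s, a) \<in> places (system_net S) \<and> a \<in> \<iota> (State s) \<and>
        (\<exists>k\<in>{1..num S}. s = init_state (ctype S k) \<and> a \<in> {1..insts S k}))"
    unfolding init ..
  also have "\<dots> \<longleftrightarrow> (\<exists>k\<in>{1..num S}. \<exists>a\<in>{1..insts S k}.
      (init_state (ctype S k), a) \<in> places (system_net S) \<and> a \<in> \<iota> (State (init_state (ctype S k))))"
    by blast
  also have "\<dots> \<longleftrightarrow> (\<exists>k\<in>{1..num S}. \<exists>a\<in>{1..insts S k}. a \<in> \<iota> (State (init_state (ctype S k))))"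
  proof -
    have "init_state (ctype S k) \<in> states (ctype S k)" if "k \<in> {1..num S}" for k
      using component_type_ctype[OF that] by (simp add: component_type_def)
    then show ?thesis
      by (intro bex_cong refl) (simp add: place_iff)
  qed
  also have "\<dots> \<longleftrightarrow> sat (insts S) \<nu> \<iota> (init_mil S)"
    by (auto simp: init_mil_def atLeastLessThanSuc_atLeastAtMost simp del: upt_Suc)
  finally show ?thesis .
qed

section \<open>Truth value of the trap invariant\<close>

lemma finite_places: "finite (places (system_net S))"
proof -
  have "places (system_net S) \<subseteq> (\<Union>k\<in>{1..num S}. states (ctype S k) \<times> {1..insts S k})"
    by (auto simp: system_net_def)
  then show ?thesis
    by (rule finite_subset) (use component_type_ctype in \<open>auto simp: component_type_def\<close>)
qed

text \<open>\<open>Abs_fset\<close> is faithful only on finite sets. Traps are subsets of the finite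
  set of places, so each is finite and there are finitely many of them.\<close>

lemma beval_trap_invariant:
  fixes \<beta> :: "('p, 's) pred \<times> nat \<Rightarrow> bool"
  shows "beval \<beta> (trap_invariant (system_net S)) \<longleftrightarrow>
    (\<forall>W. trap (system_net S) W \<longrightarrow> marked (system_net S) W \<longrightarrow> (\<exists>(s, a)\<in>W. \<beta> (State s, a)))"
proof -
  let ?N = "system_net S"
  let ?T = "{W. trap ?N W \<and> marked ?N W}"
  let ?D = "\<lambda>W. BDisj (Abs_fset ((\<lambda>(s, a). BVar (State s, a)) ` W)) :: (('p, 's) pred \<times> nat) bform"
  have sub: "?T \<subseteq> Pow (places ?N)"
    by (auto simp: trap_def)
  then have "finite ?T"
    using finite_places by (simp add: finite_subset)
  moreover have "trap_invariant ?N = BConj (Abs_fset (?D ` ?T))"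
    unfolding trap_invariant_def by (rule arg_cong[where f = "\<lambda>X. BConj (Abs_fset X)"]) blast
  moreover have "beval \<beta> (?D W) \<longleftrightarrow> (\<exists>(s, a)\<in>W. \<beta> (State s, a))" if "W \<in> ?T" for W
  proof -
    from that sub have "finite W"
      using finite_places by (auto intro: finite_subset)
    then show ?thesis
      by (auto simp: Abs_fset_inverse split: prod.splits) 
  qed
  ultimately have "beval \<beta> (trap_invariant ?N) \<longleftrightarrow> (\<forall>W\<in>?T. \<exists>(s, a)\<in>W. \<beta> (State s, a))"
    by (simp add: Abs_fset_inverse)
  then show ?thesis
    by blast
qed

text \<open>Each state is interpreted by its indices in \<open>W\<close> and each port by the empty
  set, which is the least interpretation with these places. The third property records this for
  comparison with other structures.\<close>

lemma places_of_surj: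
  assumes "W \<subseteq> places (system_net S)" "\<nu> \<in> all_vars S \<rightarrow>\<^sub>E univ S"
  obtains \<iota> where "(\<nu>, \<iota>) \<in> structs S" "places_of \<iota> = W"
    "\<forall>q\<in>all_preds S. \<iota> q = {a. \<exists>s. q = State s \<and> (s, a) \<in> W}"
proof
  let ?\<iota> = "\<lambda>q\<in>all_preds S. {a. \<exists>s. q = State s \<and> (s, a) \<in> W}"
  show "(\<nu>, ?\<iota>) \<in> structs S"
    using assms place_wf by (auto simp: structs_def)
  show "places_of ?\<iota> = W"
    using assms(1) place_wf by (auto simp: places_of_def)
qed simp

section \<open>Comparison of both sides at a fixed valuation\<close>

lemma beval_trap_invariant_iff_unfolding:
  assumes pos: "positivation S pos" and cov: "interactions_covered S"
  shows "beval \<beta> (trap_invariant (system_net S)) \<longleftrightarrow>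
    beval \<beta> (bool_unfolding (insts S) (dual (nnf True (pos (MAnd (trap_mil S) (init_mil S))))))"
proof -
  let ?N = "system_net S" and ?\<phi> = "MAnd (trap_mil S) (init_mil S)"
  obtain \<nu> where \<nu>: "\<nu> \<in> all_vars S \<rightarrow>\<^sub>E univ S"
    using ex_assignment by blast
  \<comment> \<open>The complement of \<open>\<beta>\<close>, cut down to the universe and to
    \<open>all_preds S\<close> so as to be part of a structure. Sentences of the system cannot see
    the cut.\<close>
  define \<iota> where "\<iota> = (\<lambda>q\<in>all_preds S. {a \<in> univ S. \<not> \<beta> (q, a)})"
  have str: "(\<nu>, \<iota>) \<in> structs S"
    using \<nu> by (auto simp: structs_def \<iota>_def)
  have \<phi>: "mil_sentence S ?\<phi>"
    using sentence_trap_mil sentence_init_mil by (simp add: mil_sentence_def)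
  with pos have pos\<phi>: "mil_sentence S (pos ?\<phi>)" "positive (pos ?\<phi>)"
    unfolding positivation_def by blast+
  have models: "I \<in> models S ?\<phi> \<longleftrightarrow>
      I \<in> structs S \<and> trap ?N (places_of (snd I)) \<and> marked ?N (places_of (snd I))" for I
    using trap_places_of_iff[OF cov, of "snd I" "fst I"] marked_places_of_iff[of "snd I" "fst I"]
    by (cases I) (simp add: models_def)
  have "beval \<beta> (bool_unfolding (insts S) (dual (nnf True (pos ?\<phi>)))) \<longleftrightarrow>
      \<not> sat (insts S) (\<lambda>_. 0) (\<lambda>q. {a. \<not> \<beta> (q, a)}) (pos ?\<phi>)"
    using pos\<phi>(2) by (simp add: bool_unfolding_def positive_def beval_unfold_dual_nnf)
  also have "\<dots> \<longleftrightarrow> \<not> sat (insts S) \<nu> \<iota> (pos ?\<phi>)"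
  proof -
    have "sat (insts S) (\<lambda>_. 0) (\<lambda>q. {a. \<not> \<beta> (q, a)}) (pos ?\<phi>) = sat (insts S) \<nu> \<iota> (pos ?\<phi>)"
    proof (rule sat_sentence_cong[OF pos\<phi>(1)])
      fix k q a
      assume k: "k \<in> {1..num S}" "q \<in> preds_of S k" "a \<in> {1..insts S k}"
      have "q \<in> all_preds S"
        using k(1,2) unfolding all_preds_def by blast
      moreover have "a \<in> univ S"
        using insts_subset_univ[OF k(1)] k(3) by blast
      ultimately show "a \<in> {a. \<not> \<beta> (q, a)} \<longleftrightarrow> a \<in> \<iota> q"
        by (simp add: \<iota>_def)
    qed
    then show ?thesis
      by simp
  qed
  also have "\<dots> \<longleftrightarrow> \<not> (\<exists>J\<in>models S ?\<phi>. struct_le S J (\<nu>, \<iota>))"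
    using sat_positivation_iff[OF finite_all_preds pos \<phi> str] by simp
  also have "\<dots> \<longleftrightarrow> (\<forall>W. trap ?N W \<longrightarrow> marked ?N W \<longrightarrow> (\<exists>(s, a)\<in>W. \<beta> (State s, a)))"
  proof (intro iffI allI impI notI)
    fix W assume none: "\<not> (\<exists>J\<in>models S ?\<phi>. struct_le S J (\<nu>, \<iota>))" and W: "trap ?N W" "marked ?N W"
    show "\<exists>(s, a)\<in>W. \<beta> (State s, a)"
    proof (rule ccontr)
      assume false: "\<not> (\<exists>(s, a)\<in>W. \<beta> (State s, a))"
      from W(1) have "W \<subseteq> places ?N"
        by (simp add: trap_def)
      from places_of_surj[OF this \<nu>] obtain \<kappa> where \<kappa>: "(\<nu>, \<kappa>) \<in> structs S" "places_of \<kappa> = W"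
        "\<forall>q\<in>all_preds S. \<kappa> q = {a. \<exists>s. q = State s \<and> (s, a) \<in> W}" .
      then have "(\<nu>, \<kappa>) \<in> models S ?\<phi>"
        using W by (simp add: models)
      \<comment> \<open>Ports are empty in \<open>\<kappa>\<close>, and all places in
        \<open>W\<close> are false under \<open>\<beta>\<close>, so \<open>\<iota>\<close> contains
        them.\<close>
      moreover have "\<kappa> q \<subseteq> \<iota> q" if "q \<in> all_preds S" for q
      proof -
        have "\<kappa> q \<subseteq> univ S"
          using \<kappa>(1) PiE_mem[OF _ that, of \<kappa> "\<lambda>_. Pow (univ S)"] by (simp add: structs_def)
        then show ?thesis
          using bspec[OF \<kappa>(3) that] false that by (auto simp: \<iota>_def)
      qed
      then have "struct_le S (\<nu>, \<kappa>) (\<nu>, \<iota>)"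
        by (simp add: struct_le_def)
      ultimately show False
        using none by blast
    qed
  next
    assume all: "\<forall>W. trap ?N W \<longrightarrow> marked ?N W \<longrightarrow> (\<exists>(s, a)\<in>W. \<beta> (State s, a))"
      and "\<exists>J\<in>models S ?\<phi>. struct_le S J (\<nu>, \<iota>)"
    then obtain J where J: "J \<in> models S ?\<phi>" "struct_le S J (\<nu>, \<iota>)"
      by blast
    \<comment> \<open>The places of the model \<open>J\<close> form a marked trap, so
      \<open>\<beta>\<close> makes one of them true; but \<open>J\<close> lies below
      \<open>\<iota>\<close>, which contains only places that are false under
      \<open>\<beta>\<close>.\<close>
    from J(1) have "\<exists>(s, a)\<in>places_of (snd J). \<beta> (State s, a)"
      using all unfolding models by blast
    then obtain s a where sa: "(s, a) \<in> places_of (snd J)" "\<beta> (State s, a)"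
      by blast
    then have s: "State s \<in> all_preds S"
      by (intro place_wf(1)[of s a]) (simp add: places_of_def)
    from sa(1) have "a \<in> snd J (State s)"
      by (simp add: places_of_def)
    moreover have "snd J (State s) \<subseteq> \<iota> (State s)"
      using J(2) s by (simp add: struct_le_def)
    ultimately have "a \<in> \<iota> (State s)"
      by blast
    with s sa(2) show False
      by (simp add: \<iota>_def)
  qed
  finally show ?thesis
    by (simp add: beval_trap_invariant)
qed

end

theorem theorem2:
  fixes S :: "('p, 's) system" and pos :: "('p, 's) mil \<Rightarrow> ('p, 's) mil"
  assumes "parametric_system S"
    and "positivation S pos"
    and "interactions_covered S"
  shows "bequiv (trap_invariant (system_net S))
           (bool_unfolding (insts S) (dual (nnf True (pos (MAnd (trap_mil S) (init_mil S))))))"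
  unfolding bequiv_def using beval_trap_invariant_iff_unfolding[OF assms] by blast

end
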